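(* Let $\nu$ be a finite signed Borel measure on $\mathbb{R}_+$, let $f\in L^1_{loc}(\mathbb{R}_+;\mathbb{R})$, $\xi\in\mathbb{R}$, and let $x$ be the solution of $$\dot{x}(t)=\int_{[0,t]}x(t-s)\,\nu(ds)+f(t),\quad t\ge 0;\qquad x(0)=\xi .$$ Let $r$ be the differential resolvent of $\nu$ and assume $r\in L^1(\mathbb{R}_+;\mathbb{R})$. Then the following statements are true. (i) The function $t\mapsto\int_t^{t+\theta}f(s)\,ds$ belongs to $\mathrm{Ces}(\mathbb{R}_+;\mathbb{R})$ for all $\theta\in(0,1]$ if and only if $x\in\mathrm{Ces}(\mathbb{R}_+;\mathbb{R})$. (ii) $f\in\mathrm{Ces}(\mathbb{R}_+;\mathbb{R})$ if and only if both $x\in\mathrm{Ces}(\mathbb{R}_+;\mathbb{R})$ and $\dot{x}\in\mathrm{Ces}(\mathbb{R}_+;\mathbb{R})$. Moreover, in each case the limits are given explicitly. In case (i), when the equivalent conditions hold, there is $C\in\mathbb{R}$ such that, as $t\to\infty$, $$\frac1t\int_0^t\int_s^{s+\theta}f(u)\,du\,ds\to C\theta \ \text{ for all }\theta\in(0,1],\qquad \frac1t\int_0^t x(s)\,ds\to\frac{-C}{\nu(\mathbb{R}_+)}.$$ In case (ii), when the equivalent conditions hold, there is $C\in\mathbb{R}$ such that, as $t\to\infty$, $$\frac1t\int_0^t f(s)\,ds\to C,\qquad \frac1t\int_0^t x(s)\,ds\to\frac{-C}{\nu(\mathbb{R}_+)},\qquad \frac1t\int_0^t\dot{x}(s)\,ds\to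 0.$$
   Context: $\mathbb{R}_+=[0,\infty)$. $L^1_{loc}(\mathbb{R}_+;\mathbb{R})$ is the space of functions that are Lebesgue integrable on every compact subset of $\mathbb{R}_+$. A solution $x$ of the equation is a locally absolutely continuous function on $\mathbb{R}_+$ satisfying the initial condition and the equation for almost all $t>0$; such a solution exists since $f\in L^1_{loc}$. The differential resolvent $r$ of $\nu$ is the unique locally absolutely continuous function $r:\mathbb{R}_+\to\mathbb{R}$ satisfying $\dot r(t)=\int_{[0,t]}r(t-s)\,\nu(ds)$ for (almost all) $t>0$, with $r(0)=1$. The space of Cesàro functions is $$\mathrm{Ces}(\mathbb{R}_+;\mathbb{R})=\Big\{g\in L^1_{loc}(\mathbb{R}_+;\mathbb{R}):\ \lim_{t\to\infty}\frac1t\int_0^t g(s)\,ds=C\ \text{for some } C\in\mathbb{R}\Big\}.$$ *)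

theory Defs
  imports "HOL-Analysis.Analysis"
begin

text \<open>Functions on $[0,\infty)$ are total functions on the reals; none of the notions below
  depends on their values at negative arguments.\<close>

definition L1_loc :: "(real \<Rightarrow> real) set" where
  "L1_loc = {g. \<forall>K. compact K \<and> K \<subseteq> {0..} \<longrightarrow> set_integrable lebesgue K g}"

definition cesaro_mean :: "(real \<Rightarrow> real) \<Rightarrow> real \<Rightarrow> real" where
  "cesaro_mean g t = (1 / t) * (LINT s:{0..t}|lebesgue. g s)"

definition Ces :: "(real \<Rightarrow> real) set" where
  "Ces = {g \<in> L1_loc. \<exists>C. (cesaro_mean g \<longlongrightarrow> C) at_top}"

text \<open>The usual \<open>\<epsilon>\<close>-\<open>\<delta>\<close> notion; \<open>d division_of \<Union>d\<close> says that \<open>d\<close> is a finite family of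
  nonempty compact intervals with pairwise disjoint interiors.\<close>

definition absolutely_continuous_on :: "real set \<Rightarrow> (real \<Rightarrow> real) \<Rightarrow> bool" where
  "absolutely_continuous_on S g \<longleftrightarrow>
     (\<forall>\<epsilon>>0. \<exists>\<delta>>0. \<forall>d. d division_of \<Union>d \<and> \<Union>d \<subseteq> S \<and> (\<Sum>k\<in>d. Sup k - Inf k) < \<delta> \<longrightarrow>
        (\<Sum>k\<in>d. \<bar>g (Sup k) - g (Inf k)\<bar>) < \<epsilon>)"

definition locally_absolutely_continuous :: "(real \<Rightarrow> real) \<Rightarrow> bool" where
  "locally_absolutely_continuous g \<longleftrightarrow> (\<forall>T\<ge>0. absolutely_continuous_on {0..T} g)"

text \<open>A finite signed measure is a real-valued countably additive set function on the
  \<open>\<sigma>\<close>-algebra of \<open>M\<close>; only the space and the measurable sets of \<open>M\<close> matter.\<close>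

definition finite_signed_measure :: "'a measure \<Rightarrow> ('a set \<Rightarrow> real) \<Rightarrow> bool" where
  "finite_signed_measure M \<nu> \<longleftrightarrow>
     \<nu> {} = 0 \<and>
     (\<forall>A :: nat \<Rightarrow> 'a set. range A \<subseteq> sets M \<longrightarrow> disjoint_family A \<longrightarrow>
        (\<lambda>i. \<nu> (A i)) sums \<nu> (\<Union>i. A i))"

text \<open>The positive part of the Jordan decomposition; the negative part of \<open>\<nu>\<close> is the positive
  part of \<open>- \<nu>\<close>.\<close>

definition positive_variation :: "'a measure \<Rightarrow> ('a set \<Rightarrow> real) \<Rightarrow> 'a measure" where
  "positive_variation M \<nu> =
     measure_of (space M) (sets M) (\<lambda>A. SUP B\<in>{B \<in> sets M. B \<subseteq> A}. ennreal (\<nu> B))"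

definition signed_integral :: "'a measure \<Rightarrow> ('a set \<Rightarrow> real) \<Rightarrow> ('a \<Rightarrow> real) \<Rightarrow> real" where
  "signed_integral M \<nu> h =
     integral\<^sup>L (positive_variation M \<nu>) h - integral\<^sup>L (positive_variation M (\<lambda>A. - \<nu> A)) h"

abbreviation borel_Rplus :: "real measure" where
  "borel_Rplus \<equiv> restrict_space borel {0..}"

definition measure_convolution :: "(real set \<Rightarrow> real) \<Rightarrow> (real \<Rightarrow> real) \<Rightarrow> real \<Rightarrow> real" where
  "measure_convolution \<nu> x t =
     signed_integral borel_Rplus \<nu> (\<lambda>s. indicator {0..t} s * x (t - s))"

definition is_solution ::
  "(real set \<Rightarrow> real) \<Rightarrow> (real \<Rightarrow> real) \<Rightarrow> real \<Rightarrow> (real \<Rightarrow> real) \<Rightarrow> bool" where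
  "is_solution \<nu> f \<xi> x \<longleftrightarrow>
     locally_absolutely_continuous x \<and> x 0 = \<xi> \<and>
     (AE t in lebesgue. t > 0 \<longrightarrow>
        (x has_real_derivative (measure_convolution \<nu> x t + f t)) (at t))"

definition is_differential_resolvent :: "(real set \<Rightarrow> real) \<Rightarrow> (real \<Rightarrow> real) \<Rightarrow> bool" where
  "is_differential_resolvent \<nu> r \<longleftrightarrow>
     locally_absolutely_continuous r \<and> r 0 = 1 \<and>
     (AE t in lebesgue. t > 0 \<longrightarrow> (r has_real_derivative measure_convolution \<nu> r t) (at t))"

end

theory Submission
  imports Defs
begin

text \<open>
  Write \<open>X\<close> and \<open>F\<close> for the primitives of \<open>x\<close> and \<open>f\<close>, and call the limit of \<open>g t / t\<close> at infinity the
  slope of \<open>g\<close>. A Cesaro mean of a function is the slope of its primitive, so the theorem is about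
  slopes. Integrating the equation gives \<open>x = \<xi> + \<nu> * X + F\<close>, which involves \<open>f\<close> only
  through the continuous function \<open>F\<close>, and integrating the resolvent equation gives \<open>r = 1 + \<nu> * R\<close> with \<open>R\<close> the primitive of
  \<open>r\<close>. Convolution of the first identity with \<open>r\<close>, where the second is used to expand one of the
  factors, yields \<open>X = \<xi> R + r * F\<close> (\<open>variation_of_constants\<close>); it needs only that convolutions
  commute with each other (\<open>conv_commute\<close>, \<open>conv_lborel_commute\<close>).

  The single analytic tool on the convolution side is dominated convergence: convolution with an
  integrable kernel of total integral \<open>m\<close> multiplies slopes by \<open>m\<close> (\<open>conv_slope\<close>). Applied to the
  primitive of \<open>r = 1 + \<nu> * R\<close> it shows that the integral of \<open>r\<close> times \<open>\<nu> {0..}\<close> is \<open>-1\<close> (\<open>mass_resolvent\<close>), so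
  \<open>\<nu> {0..}\<close> is not zero. For (ii), a slope \<open>C\<close> of \<open>F\<close> gives the slope \<open>-C / \<nu> {0..}\<close> of \<open>X = \<xi> R + r * F\<close>,
  and the integrated equation relates the slopes of \<open>x\<close>, \<open>X\<close> and \<open>F\<close>, where \<open>x - \<xi>\<close> is the primitive of
  the derivative of \<open>x\<close>.

  For (i), let \<open>G\<close> be the primitive of \<open>F\<close>. The hypothesis on windows of length \<open>\<theta>\<close> says that
  \<open>(G (t + \<theta>) - G t) / t\<close> converges for \<open>0 < \<theta> \<le> 1\<close>. If \<open>X\<close> has a slope, this follows from the integrated
  equation by the mean value theorem (\<open>increment_of_primitive_slope\<close>). Conversely \<open>F\<close> itself may have
  no slope, but its moving average \<open>G (t + 1) - G t\<close> does. The remainder \<open>E t = F t - (G (t + 1) - G t)\<close>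
  has a primitive with a slope, because that primitive is, up to a constant, minus the average of the
  increments \<open>G (t + \<theta>) - G t\<close> over \<open>0 \<le> \<theta> \<le> 1\<close>; the passage to the limit under this average needs a
  bound uniform in \<open>\<theta>\<close>, which Baire's theorem provides (\<open>increments_locally_bounded\<close>). Since
  \<open>r * E\<close> equals \<open>I E + \<nu> * (r * I E)\<close>, with \<open>I E\<close> the primitive of \<open>E\<close>, the two contributions to its
  slope cancel (\<open>smoothing_slope\<close>), and \<open>X\<close> has a slope.

  Two general facts support this reduction: a finite signed measure is the difference of two finite
  measures, and an absolutely continuous function is the integral of its almost everywhere derivative.
\<close>

section \<open>The Jordan decomposition of a finite signed measure\<close>

lemma finite_signed_measure_uminus:
  assumes "finite_signed_measure M \<nu>"
  shows "finite_signed_measure M (\<lambda>A. - \<nu> A)"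
  using assms by (auto simp: finite_signed_measure_def intro: sums_minus)

context
  fixes M :: "'a measure" and \<nu> :: "'a set \<Rightarrow> real"
  assumes signed: "finite_signed_measure M \<nu>"
begin

lemma signed_measure_empty: "\<nu> {} = 0"
  using signed by (simp add: finite_signed_measure_def)

lemma signed_measure_sums:
  fixes A :: "nat \<Rightarrow> 'a set"
  assumes "\<And>i. A i \<in> sets M" "disjoint_family A"
  shows "(\<lambda>i. \<nu> (A i)) sums \<nu> (\<Union>i. A i)"
  using signed assms unfolding finite_signed_measure_def by blast

lemma signed_measure_Un:
  assumes "A \<in> sets M" "B \<in> sets M" "A \<inter> B = {}"
  shows "\<nu> (A \<union> B) = \<nu> A + \<nu> B"
proof -
  have "(\<lambda>i. \<nu> (binaryset A B i)) sums \<nu> (\<Union>i. binaryset A B i)"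
    using assms by (intro signed_measure_sums) (auto simp: binaryset_def disjoint_family_on_def)
  moreover have "(\<lambda>i. \<nu> (binaryset A B i)) sums (\<nu> A + \<nu> B)"
    by (rule binaryset_sums) (rule signed_measure_empty)
  ultimately show ?thesis
    by (simp add: UN_binaryset_eq sums_iff)
qed

lemma signed_measure_Diff:
  assumes "A \<in> sets M" "B \<in> sets M" "B \<subseteq> A"
  shows "\<nu> (A - B) = \<nu> A - \<nu> B"
  using signed_measure_Un[of "A - B" B] assms by (simp add: Un_absorb2 Int_commute)

text \<open>A set is bad if \<open>\<nu>\<close> is unbounded on its measurable subsets. A bad set \<open>A\<close> splits into two parts
  both of absolute measure at least 1, and one of them is bad again. Iteration gives disjoint
  differences whose measures do not tend to zero, against countable additivity.\<close>

lemma signed_measure_bounded: "\<exists>b. \<forall>A\<in>sets M. \<bar>\<nu> A\<bar> \<le> b"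
proof (rule ccontr)
  define bad where "bad A \<longleftrightarrow> A \<in> sets M \<and> (\<forall>b. \<exists>B\<in>sets M. B \<subseteq> A \<and> \<bar>\<nu> B\<bar> > b)" for A
  have step: "\<exists>B. bad B \<and> B \<subseteq> A \<and> \<bar>\<nu> (A - B)\<bar> \<ge> 1" if A: "bad A" for A
  proof -
    have Am: "A \<in> sets M" using A by (simp add: bad_def)
    obtain B where B: "B \<in> sets M" "B \<subseteq> A" "\<bar>\<nu> B\<bar> > \<bar>\<nu> A\<bar> + 1"
      using A unfolding bad_def by blast
    have D: "\<nu> (A - B) = \<nu> A - \<nu> B"
      using signed_measure_Diff Am B by simp
    \<comment> \<open>If \<open>\<nu>\<close> were bounded on the subsets of both parts, it would be so on those of \<open>A\<close>.\<close>
    have "bad B \<or> bad (A - B)"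
    proof (rule ccontr)
      assume "\<not> (bad B \<or> bad (A - B))"
      then obtain b1 b2 where
        b1: "\<And>C. C \<in> sets M \<Longrightarrow> C \<subseteq> B \<Longrightarrow> \<bar>\<nu> C\<bar> \<le> b1" and
        b2: "\<And>C. C \<in> sets M \<Longrightarrow> C \<subseteq> A - B \<Longrightarrow> \<bar>\<nu> C\<bar> \<le> b2"
        using B Am unfolding bad_def by (meson not_le sets.Diff)
      obtain C where C: "C \<in> sets M" "C \<subseteq> A" "\<bar>\<nu> C\<bar> > b1 + b2"
        using A unfolding bad_def by blast
      have "\<nu> ((C \<inter> B) \<union> (C - B)) = \<nu> (C \<inter> B) + \<nu> (C - B)"
        using C B by (intro signed_measure_Un) auto
      then have "\<nu> C = \<nu> (C \<inter> B) + \<nu> (C - B)"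
        by (simp add: Int_Diff_Un)
      moreover have "\<bar>\<nu> (C \<inter> B)\<bar> \<le> b1" "\<bar>\<nu> (C - B)\<bar> \<le> b2"
        using C B by (auto intro!: b1 b2)
      ultimately show False using C by linarith
    qed
    then show ?thesis
    proof
      assume "bad B"
      then show ?thesis using B D by (intro exI[of _ B]) auto
    next
      assume "bad (A - B)"
      moreover have "A - (A - B) = B" using B by auto
      ultimately show ?thesis using B by (intro exI[of _ "A - B"]) auto
    qed
  qed
  assume "\<not> ?thesis"
  then have "bad (space M)"
    unfolding bad_def by (meson not_le sets.sets_into_space sets.top)
  then have "\<exists>A. \<forall>n. bad (A n) \<and> (A (Suc n) \<subseteq> A n \<and> \<bar>\<nu> (A n - A (Suc n))\<bar> \<ge> 1)"
    by (intro dependent_nat_choice step) auto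
  then obtain A where A: "\<And>n. bad (A n)"
    and AS: "\<And>n. A (Suc n) \<subseteq> A n" "\<And>n. \<bar>\<nu> (A n - A (Suc n))\<bar> \<ge> 1"
    by auto
  have dec: "A n \<subseteq> A m" if "m \<le> n" for m n
    using that AS(1) by (rule lift_Suc_antimono_le[rotated])
  have "disjoint_family (\<lambda>n. A n - A (Suc n))"
    unfolding disjoint_family_on_def
  proof (intro ballI impI)
    fix m n :: nat assume "m \<noteq> n"
    then consider "Suc m \<le> n" | "Suc n \<le> m" by linarith
    then show "(A m - A (Suc m)) \<inter> (A n - A (Suc n)) = {}"
      by cases (use dec in blast)+
  qed
  then have "(\<lambda>n. \<nu> (A n - A (Suc n))) sums \<nu> (\<Union>n. A n - A (Suc n))"
    using A by (intro signed_measure_sums) (auto simp: bad_def)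
  then have "(\<lambda>n. \<nu> (A n - A (Suc n))) \<longlonglongrightarrow> 0"
    by (simp add: sums_summable summable_LIMSEQ_zero)
  then have "\<forall>\<^sub>F n in sequentially. dist (\<nu> (A n - A (Suc n))) 0 < 1"
    by (rule tendstoD) simp
  then show False
    using AS(2) by (auto simp: eventually_sequentially) (meson le_refl not_le)
qed

lemma space_positive_variation: "space (positive_variation M \<nu>) = space M"
  and sets_positive_variation: "sets (positive_variation M \<nu>) = sets M"
  by (simp_all add: positive_variation_def)

text \<open>The set function in the definition of the positive variation is countably additive, so that it is
  the measure of every measurable set. Superadditivity comes from joining subsets of disjoint sets,
  where a subset of negative measure is traded for the empty set; the converse inequality comes from
  cutting a subset of the union into its pieces.\<close>

lemma emeasure_positive_variation:
  assumes "A \<in> sets M"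
  shows "emeasure (positive_variation M \<nu>) A = (SUP B\<in>{B \<in> sets M. B \<subseteq> A}. ennreal (\<nu> B))"
proof -
  define p where "p A = (SUP B\<in>{B \<in> sets M. B \<subseteq> A}. ennreal (\<nu> B))" for A
  have p_upper: "ennreal (\<nu> B) \<le> p A" if "B \<in> sets M" "B \<subseteq> A" for A B
    unfolding p_def using that by (intro SUP_upper) auto
  have p_mono: "p A \<le> p B" if "A \<subseteq> B" for A B
    unfolding p_def using that by (intro SUP_subset_mono) auto
  have super: "p A + p B \<le> p (A \<union> B)" if "A \<inter> B = {}" for A B
  proof -
    have ne: "{B \<in> sets M. B \<subseteq> A} \<noteq> {}" for A by auto
    have add: "ennreal (\<nu> C) + ennreal (\<nu> D) \<le> p (A \<union> B)"
      if "C \<in> sets M" "C \<subseteq> A" "D \<in> sets M" "D \<subseteq> B" for C D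
    proof -
      consider "\<nu> C \<le> 0" | "\<nu> D \<le> 0" | "\<nu> C \<ge> 0" "\<nu> D \<ge> 0" by linarith
      then show ?thesis
      proof cases
        case 1 then show ?thesis using that p_upper[of D "A \<union> B"] by (auto simp: ennreal_neg)
      next
        case 2 then show ?thesis using that p_upper[of C "A \<union> B"] by (auto simp: ennreal_neg)
      next
        case 3
        have "C \<inter> D = {}" using that \<open>A \<inter> B = {}\<close> by auto
        then have "\<nu> (C \<union> D) = \<nu> C + \<nu> D" using that by (intro signed_measure_Un)
        then show ?thesis using 3 that p_upper[of "C \<union> D" "A \<union> B"]
          by (auto simp: ennreal_plus)
      qed
    qed
    have add_p: "ennreal (\<nu> C) + p B \<le> p (A \<union> B)" if "C \<in> sets M" "C \<subseteq> A" for C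
      unfolding p_def[of B] ennreal_SUP_add_right[OF ne]
      by (rule SUP_least) (use that add in auto)
    have "p A + p B = (SUP C\<in>{C \<in> sets M. C \<subseteq> A}. ennreal (\<nu> C) + p B)"
      unfolding p_def[of A] by (rule ennreal_SUP_add_left[OF ne, symmetric])
    also have "\<dots> \<le> p (A \<union> B)"
      by (rule SUP_least) (use add_p in auto)
    finally show ?thesis .
  qed
  have "countably_additive (sets M) p"
  proof (rule countably_additiveI)
    fix A :: "nat \<Rightarrow> 'a set"
    assume A: "range A \<subseteq> sets M" "disjoint_family A" "\<Union> (range A) \<in> sets M"
    show "(\<Sum>i. p (A i)) = p (\<Union> (range A))"
    proof (rule antisym)
      have "(\<Sum>i<n. p (A i)) \<le> p (\<Union>i<n. A i)" for n
      proof (induction n)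
        case (Suc n)
        have "A i \<inter> A n = {}" if "i < n" for i
          using A(2) that by (simp add: disjoint_family_on_def)
        then have "(\<Union>i<n. A i) \<inter> A n = {}"
          by blast
        from super[OF this] have "p (\<Union>i<n. A i) + p (A n) \<le> p (\<Union>i<Suc n. A i)"
          by (simp add: lessThan_Suc Un_commute)
        moreover have "(\<Sum>i<Suc n. p (A i)) \<le> p (\<Union>i<n. A i) + p (A n)"
          using Suc by (simp add: add_right_mono)
        ultimately show ?case
          by (rule order_trans[rotated])
      qed simp
      also have "p (\<Union>i<n. A i) \<le> p (\<Union> (range A))" for n
        by (rule p_mono) auto
      finally show "(\<Sum>i. p (A i)) \<le> p (\<Union> (range A))"
        by (auto intro: suminf_le_const)
    next
      have "ennreal (\<nu> B) \<le> (\<Sum>i. p (A i))" if B: "B \<in> sets M" "B \<subseteq> \<Union> (range A)" for B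
      proof -
        have "(\<lambda>i. \<nu> (B \<inter> A i)) sums \<nu> (\<Union>i. B \<inter> A i)"
          using A B by (intro signed_measure_sums) (auto simp: disjoint_family_on_def)
        moreover have "(\<Union>i. B \<inter> A i) = B" using B by auto
        ultimately have s: "(\<lambda>n. \<Sum>i<n. \<nu> (B \<inter> A i)) \<longlonglongrightarrow> \<nu> B"
          by (simp add: sums_def)
        have "ennreal (\<Sum>i<n. \<nu> (B \<inter> A i)) \<le> (\<Sum>i. p (A i))" for n
        proof -
          have "ennreal (\<Sum>i<n. \<nu> (B \<inter> A i)) \<le> ennreal (\<Sum>i<n. max 0 (\<nu> (B \<inter> A i)))"
            by (intro ennreal_leI sum_mono) auto
          also have "\<dots> = (\<Sum>i<n. ennreal (max 0 (\<nu> (B \<inter> A i))))"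
            by (simp add: sum_ennreal)
          also have "\<dots> \<le> (\<Sum>i<n. p (A i))"
          proof (rule sum_mono)
            fix i
            have "ennreal (max 0 (\<nu> (B \<inter> A i))) = ennreal (\<nu> (B \<inter> A i))"
              by (simp add: max_def ennreal_neg)
            also have "\<dots> \<le> p (A i)"
              using A B by (intro p_upper) auto
            finally show "ennreal (max 0 (\<nu> (B \<inter> A i))) \<le> p (A i)" .
          qed
          also have "\<dots> \<le> (\<Sum>i. p (A i))"
            by (intro sum_le_suminf) auto
          finally show ?thesis .
        qed
        then show ?thesis
          using s by (intro LIMSEQ_le_const2[OF tendsto_ennrealI[OF s]]) auto
      qed
      then show "p (\<Union> (range A)) \<le> (\<Sum>i. p (A i))"
        unfolding p_def[of "\<Union> (range A)"] by (auto intro!: SUP_least)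
    qed
  qed
  moreover have "positive (sets M) p"
    unfolding positive_def p_def by (simp add: signed_measure_empty cong: conj_cong)
  ultimately show ?thesis
    unfolding positive_variation_def p_def using assms
    by (intro emeasure_measure_of_sigma sets.sigma_algebra_axioms) auto
qed

lemma finite_measure_positive_variation: "finite_measure (positive_variation M \<nu>)"
proof
  obtain b where b: "\<And>A. A \<in> sets M \<Longrightarrow> \<bar>\<nu> A\<bar> \<le> b"
    using signed_measure_bounded by auto
  have "emeasure (positive_variation M \<nu>) (space M) \<le> ennreal b"
    unfolding emeasure_positive_variation[OF sets.top]
  proof (rule SUP_least)
    fix B assume "B \<in> {B \<in> sets M. B \<subseteq> space M}"
    then show "ennreal (\<nu> B) \<le> ennreal b"
      using b[of B] by (intro ennreal_leI) auto
  qed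
  then show "emeasure (positive_variation M \<nu>) (space (positive_variation M \<nu>)) \<noteq> \<infinity>"
    by (auto simp: space_positive_variation top_unique)
qed

end

text \<open>The two inequalities express that \<open>\<nu> B\<close> and \<open>- \<nu> (space M - B)\<close> differ by \<open>\<nu> (space M)\<close>, so that
  the suprema defining the two variations differ by the same amount.\<close>

lemma jordan_decomposition_space:
  assumes signed: "finite_signed_measure M \<nu>"
  shows "\<nu> (space M) = measure (positive_variation M \<nu>) (space M)
           - measure (positive_variation M (\<lambda>A. - \<nu> A)) (space M)"
proof -
  let ?P = "positive_variation M \<nu>" and ?N = "positive_variation M (\<lambda>A. - \<nu> A)"
  let ?S = "\<nu> (space M)"
  note signed' = finite_signed_measure_uminus[OF signed]
  interpret P: finite_measure ?P by (rule finite_measure_positive_variation[OF signed])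
  interpret N: finite_measure ?N by (rule finite_measure_positive_variation[OF signed'])
  have P_le: "\<nu> A \<le> measure ?P (space M)" and N_le: "- \<nu> A \<le> measure ?N (space M)"
    if "A \<in> sets M" for A
  proof -
    have "A \<subseteq> space M" using that by (rule sets.sets_into_space)
    then have "ennreal (\<nu> A) \<le> emeasure ?P (space M)" "ennreal (- \<nu> A) \<le> emeasure ?N (space M)"
      using that emeasure_positive_variation[OF signed, of "space M"]
        emeasure_positive_variation[OF signed', of "space M"]
      by (auto intro!: SUP_upper simp del: ennreal_le_iff)
    then show "\<nu> A \<le> measure ?P (space M)" "- \<nu> A \<le> measure ?N (space M)"
      by (auto simp: P.emeasure_eq_measure N.emeasure_eq_measure)
  qed
  have "emeasure ?P (space M) \<le> ennreal (?S + measure ?N (space M))"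
    unfolding emeasure_positive_variation[OF signed sets.top]
  proof (rule SUP_least)
    fix B assume "B \<in> {B \<in> sets M. B \<subseteq> space M}"
    then have "B \<in> sets M" "\<nu> (space M - B) = ?S - \<nu> B"
      using signed_measure_Diff[OF signed, of "space M" B] by auto
    then show "ennreal (\<nu> B) \<le> ennreal (?S + measure ?N (space M))"
      using N_le[of "space M - B"] by (intro ennreal_leI) auto
  qed
  moreover have "emeasure ?N (space M) \<le> ennreal (measure ?P (space M) - ?S)"
    unfolding emeasure_positive_variation[OF signed' sets.top]
  proof (rule SUP_least)
    fix B assume "B \<in> {B \<in> sets M. B \<subseteq> space M}"
    then have "B \<in> sets M" "\<nu> (space M - B) = ?S - \<nu> B"
      using signed_measure_Diff[OF signed, of "space M" B] by auto
    then show "ennreal (- \<nu> B) \<le> ennreal (measure ?P (space M) - ?S)"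
      using P_le[of "space M - B"] by (intro ennreal_leI) auto
  qed
  moreover have "0 \<le> ?S + measure ?N (space M)" "0 \<le> measure ?P (space M) - ?S"
    using N_le[of "space M"] P_le[of "space M"] by auto
  ultimately show ?thesis
    by (simp add: P.emeasure_eq_measure N.emeasure_eq_measure)
qed

section \<open>The fundamental theorem of calculus for absolutely continuous functions\<close>

lemma absolutely_continuous_on_imp_continuous_on:
  assumes "absolutely_continuous_on {a..b} g"
  shows "continuous_on {a..b} g"
proof (rule continuous_onI)
  fix x e :: real assume x: "x \<in> {a..b}" and "e > 0"
  then obtain \<delta> where "\<delta> > 0" and \<delta>:
    "\<And>d. d division_of \<Union>d \<Longrightarrow> \<Union>d \<subseteq> {a..b} \<Longrightarrow> (\<Sum>k\<in>d. Sup k - Inf k) < \<delta> \<Longrightarrow>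
        (\<Sum>k\<in>d. \<bar>g (Sup k) - g (Inf k)\<bar>) < e"
    using assms[unfolded absolutely_continuous_on_def, rule_format, OF \<open>e > 0\<close>] by blast
  have *: "\<bar>g v - g u\<bar> < e" if "u \<in> {a..b}" "v \<in> {a..b}" "u \<le> v" "v - u < \<delta>" for u v
    using \<delta>[of "{{u..v}}"] that division_of_self[of u v] by (simp add: box_real)
  have "dist (g y) (g x) \<le> e" if "y \<in> {a..b}" "dist y x < \<delta>" for y
    using *[of x y] *[of y x] x that by (cases "x \<le> y") (auto simp: dist_real_def)
  then show "\<exists>d>0. \<forall>x'\<in>{a..b}. dist x' x < d \<longrightarrow> dist (g x') (g x) \<le> e"
    using \<open>\<delta> > 0\<close> by blast
qed

text \<open>The gauge integral makes this direct. Off an exceptional null set \<open>N\<close> the gauge is chosen as in the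
  proof of the fundamental theorem for differentiable functions. At points of \<open>N\<close> the integrand may
  be taken to be zero, and the gauge is so fine that the intervals with such a tag lie in an open set
  \<open>U\<close> of small measure; absolute continuity makes the increments of \<open>g\<close> over these intervals small.\<close>

lemma has_integral_absolutely_continuous:
  fixes g h :: "real \<Rightarrow> real"
  assumes "a \<le> b" and ac: "absolutely_continuous_on {a..b} g"
    and ae: "AE t in lebesgue. a < t \<longrightarrow> t < b \<longrightarrow> (g has_real_derivative h t) (at t)"
  shows "(h has_integral (g b - g a)) {a..b}"
proof -
  obtain N0 where N0: "negligible N0" and deriv0:
    "\<And>t. t \<notin> N0 \<Longrightarrow> a < t \<Longrightarrow> t < b \<Longrightarrow> (g has_real_derivative h t) (at t)"
    using ae unfolding eventually_ae_filter_negligible by blast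
  \<comment> \<open>The derivative at the endpoints is not given, so they join the exceptional set.\<close>
  define N where "N = insert a (insert b N0)"
  have N: "negligible N" using N0 by (simp add: N_def)
  have deriv: "(g has_real_derivative h t) (at t)" if "t \<in> {a..b}" "t \<notin> N" for t
    using that by (intro deriv0) (auto simp: N_def less_le)
  define k where "k t = (if t \<in> N then 0 else h t)" for t
  have "(k has_integral (g b - g a)) {a..b}"
    unfolding has_integral_real
  proof (intro allI impI)
    fix e :: real assume "e > 0"
    \<comment> \<open>The summand 1 covers the case \<open>a = b\<close>.\<close>
    define e1 where "e1 = e / (2 * (b - a + 1))"
    have "e1 > 0" using \<open>e > 0\<close> \<open>a \<le> b\<close> by (simp add: e1_def)
    obtain \<delta> where "\<delta> > 0" and \<delta>:
      "\<And>d. d division_of \<Union>d \<Longrightarrow> \<Union>d \<subseteq> {a..b} \<Longrightarrow> (\<Sum>k\<in>d. Sup k - Inf k) < \<delta> \<Longrightarrow>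
        (\<Sum>k\<in>d. \<bar>g (Sup k) - g (Inf k)\<bar>) < e / 2"
      using ac[unfolded absolutely_continuous_on_def, rule_format, of "e / 2"] \<open>e > 0\<close> by auto
    have "N \<in> sets lebesgue" using N by (simp add: negligible_imp_sets)
    then obtain U where U: "open U" "N \<subseteq> U" "(U - N) \<in> lmeasurable"
        "emeasure lebesgue (U - N) < ennreal \<delta>"
      using sets_lebesgue_outer_open \<open>\<delta> > 0\<close> by blast
    have N_null: "N \<in> null_sets lebesgue"
      using N by (simp add: negligible_iff_null_sets)
    have "U = (U - N) \<union> N" using U(2) by auto
    then have U_lm: "U \<in> lmeasurable"
      using U(3) N negligible_imp_measurable by (metis fmeasurable.Un)
    have "emeasure lebesgue U = emeasure lebesgue (U - N)"
      using N_null U_lm by (intro emeasure_Diff_null_set[symmetric]) (auto simp: fmeasurableD)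
    then have U_small: "measure lebesgue U < \<delta>"
      using U U_lm \<open>\<delta> > 0\<close> by (simp add: emeasure_eq_measure2 ennreal_less_iff)
    have "\<exists>d>0. (t \<in> N \<longrightarrow> ball t d \<subseteq> U) \<and> (t \<in> {a..b} - N \<longrightarrow>
            (\<forall>y. \<bar>y - t\<bar> < d \<longrightarrow> \<bar>g y - g t - h t * (y - t)\<bar> \<le> e1 * \<bar>y - t\<bar>))" for t
    proof (cases "t \<in> N")
      case True
      then show ?thesis using U by (meson DiffD2 openE subsetD)
    next
      case False
      show ?thesis
      proof (cases "t \<in> {a..b}")
        case True
        have "(g has_derivative (*) (h t)) (at t)"
          using deriv True False by (simp add: has_field_derivative_def)
        then show ?thesis
          unfolding has_derivative_at_alt using \<open>e1 > 0\<close> False by auto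
      qed (use False in \<open>auto intro: zero_less_one\<close>)
    qed
    then obtain d where d: "\<And>t. d t > 0" "\<And>t. t \<in> N \<Longrightarrow> ball t (d t) \<subseteq> U"
      and d_deriv: "\<And>t y. t \<in> {a..b} - N \<Longrightarrow> \<bar>y - t\<bar> < d t \<Longrightarrow>
             \<bar>g y - g t - h t * (y - t)\<bar> \<le> e1 * \<bar>y - t\<bar>"
      by metis
    show "\<exists>\<gamma>. gauge \<gamma> \<and> (\<forall>\<D>. \<D> tagged_division_of {a..b} \<and> \<gamma> fine \<D> \<longrightarrow>
        norm ((\<Sum>(x, K)\<in>\<D>. measure lborel K *\<^sub>R k x) - (g b - g a)) < e)"
    proof (intro exI[of _ "\<lambda>t. ball t (d t)"] conjI allI impI)
      show "gauge (\<lambda>t. ball t (d t))" using d by (auto simp: gauge_def)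
      fix \<D> assume "\<D> tagged_division_of {a..b} \<and> (\<lambda>t. ball t (d t)) fine \<D>"
      then have \<D>: "\<D> tagged_division_of {a..b}" and fine: "(\<lambda>t. ball t (d t)) fine \<D>"
        by auto
      note \<D>D = tagged_division_ofD[OF \<D>]
      have interval: "\<exists>u v. K = {u..v} \<and> u \<le> t \<and> t \<le> v \<and> {u..v} \<subseteq> {a..b} \<and> {u..v} \<subseteq> ball t (d t)"
        if tK: "(t, K) \<in> \<D>" for t K
      proof -
        obtain u v where "K = {u..v}" using \<D>D(4)[OF tK] by (auto simp: box_real)
        then show ?thesis using \<D>D(2,3)[OF tK] fineD[OF fine tK] by auto
      qed
      define \<Delta> where "\<Delta> K = g (Sup K) - g (Inf K)" for K
      define \<D>N where "\<D>N = {(t, K) \<in> \<D>. t \<in> N}"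
      have fin: "finite \<D>" and sub: "\<D>N \<subseteq> \<D>" by (auto simp: \<D>D \<D>N_def)
      have good: "(\<Sum>(t,K)\<in>\<D> - \<D>N. \<bar>measure lborel K *\<^sub>R k t - \<Delta> K\<bar>) \<le> (\<Sum>(t,K)\<in>\<D> - \<D>N. e1 * measure lborel K)"
      proof (rule sum_mono, clarify)
        fix t K assume tK: "(t, K) \<in> \<D>" "(t, K) \<notin> \<D>N"
        then obtain u v where uv: "K = {u..v}" "u \<le> t" "t \<le> v" "{u..v} \<subseteq> {a..b}" "{u..v} \<subseteq> ball t (d t)"
          using interval by blast
        have t: "t \<in> {a..b} - N" using tK uv by (auto simp: \<D>N_def)
        have "u \<in> {u..v}" "v \<in> {u..v}" using uv by auto
        then have "u \<in> ball t (d t)" "v \<in> ball t (d t)" using uv(5) by blast+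
        then have "\<bar>u - t\<bar> < d t" "\<bar>v - t\<bar> < d t"
          by (simp_all add: dist_real_def abs_minus_commute)
        then have "\<bar>g u - g t - h t * (u - t)\<bar> \<le> e1 * \<bar>u - t\<bar>"
          "\<bar>g v - g t - h t * (v - t)\<bar> \<le> e1 * \<bar>v - t\<bar>"
          using d_deriv[OF t] by blast+
        moreover have "\<bar>measure lborel K *\<^sub>R k t - \<Delta> K\<bar>
            = \<bar>(g v - g t - h t * (v - t)) - (g u - g t - h t * (u - t))\<bar>"
          using uv t by (simp add: k_def \<Delta>_def algebra_simps abs_minus_commute)
        moreover have "e1 * \<bar>v - t\<bar> + e1 * \<bar>u - t\<bar> = e1 * measure lborel K"
          using uv by (simp add: algebra_simps)
        ultimately show "\<bar>measure lborel K *\<^sub>R k t - \<Delta> K\<bar> \<le> e1 * measure lborel K"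
          by linarith
      qed
      also have "\<dots> \<le> (\<Sum>(t,K)\<in>\<D>. e1 * measure lborel K)"
        using fin \<open>e1 > 0\<close> by (intro sum_mono2) auto
      also have "\<dots> = e1 * (b - a)"
        using additive_content_tagged_division[of \<D> a b] \<D> \<open>a \<le> b\<close>
        by (simp add: sum_distrib_left[symmetric] case_prod_unfold)
      also have "\<dots> < e / 2"
        using \<open>e > 0\<close> \<open>a \<le> b\<close> by (simp add: e1_def field_simps)
      finally have good: "(\<Sum>(t,K)\<in>\<D> - \<D>N. \<bar>measure lborel K *\<^sub>R k t - \<Delta> K\<bar>) < e / 2" .

      have part: "\<D>N tagged_partial_division_of {a..b}"
        using \<D> sub unfolding tagged_division_of_def
        by (blast intro: tagged_partial_division_subset)
      have div: "snd ` \<D>N division_of \<Union>(snd ` \<D>N)"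
        by (rule partial_division_of_tagged_division[OF part])
      have length: "(\<Sum>K\<in>snd ` \<D>N. Sup K - Inf K) < \<delta>"
      proof -
        have "(\<Sum>K\<in>snd ` \<D>N. Sup K - Inf K) = (\<Sum>K\<in>snd ` \<D>N. measure lebesgue K)"
        proof (rule sum.cong[OF refl])
          fix K assume "K \<in> snd ` \<D>N"
          then obtain t where "(t, K) \<in> \<D>" using sub by auto
          from interval[OF this] obtain u v where "K = {u..v}" "u \<le> t" "t \<le> v"
            by blast
          then show "Sup K - Inf K = measure lebesgue K" by simp
        qed
        also have "\<dots> = measure lebesgue (\<Union>(snd ` \<D>N))"
          by (rule content_division[OF div])
        also have "\<dots> \<le> measure lebesgue U"
        proof (rule measure_mono_fmeasurable)
          have "K \<subseteq> U" if tK: "(t, K) \<in> \<D>" "t \<in> N" for t K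
            using interval[OF tK(1)] d(2)[OF tK(2)] by auto
          then show "\<Union>(snd ` \<D>N) \<subseteq> U"
            unfolding \<D>N_def by clarsimp blast
          show "\<Union>(snd ` \<D>N) \<in> sets lebesgue"
            using lmeasurable_division[OF div] by (simp add: fmeasurableD)
        qed (rule U_lm)
        finally show ?thesis using U_small by linarith
      qed
      \<comment> \<open>\<open>Sup {}\<close> and \<open>Inf {}\<close> have no meaning, hence the convention on the empty set.\<close>
      define \<phi> where "\<phi> K = (if K = {} then 0 else \<bar>\<Delta> K\<bar>)" for K
      have "(\<Sum>(t,K)\<in>\<D>N. \<bar>measure lborel K *\<^sub>R k t - \<Delta> K\<bar>) = (\<Sum>(t,K)\<in>\<D>N. \<phi> K)"
      proof (rule sum.cong[OF refl], clarify)
        fix t K assume "(t, K) \<in> \<D>N"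
        then have "(t, K) \<in> \<D>" "t \<in> N" by (auto simp: \<D>N_def)
        moreover from this interval have "K \<noteq> {}" by fastforce
        ultimately show "\<bar>measure lborel K *\<^sub>R k t - \<Delta> K\<bar> = \<phi> K"
          by (simp add: k_def \<phi>_def)
      qed
      also have "\<dots> = (\<Sum>K\<in>snd ` \<D>N. \<phi> K)"
      proof (rule sum.over_tagged_division_lemma[OF tagged_partial_division_of_Union_self[OF part]])
        fix u v :: real assume "box u v = {}"
        then show "\<phi> (cbox u v) = 0" by (cases "u = v") (auto simp: \<phi>_def \<Delta>_def)
      qed
      also have "\<dots> \<le> (\<Sum>K\<in>snd ` \<D>N. \<bar>g (Sup K) - g (Inf K)\<bar>)"
        by (rule sum_mono) (simp add: \<phi>_def \<Delta>_def)
      also have "\<dots> < e / 2"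
      proof (rule \<delta>[OF div _ length])
        show "\<Union>(snd ` \<D>N) \<subseteq> {a..b}"
        proof (rule Union_least)
          fix K assume "K \<in> snd ` \<D>N"
          then obtain t where "(t, K) \<in> \<D>" using sub by auto
          then show "K \<subseteq> {a..b}" by (rule \<D>D(3))
        qed
      qed
      finally have bad: "(\<Sum>(t,K)\<in>\<D>N. \<bar>measure lborel K *\<^sub>R k t - \<Delta> K\<bar>) < e / 2" .

      have "(\<Sum>(t,K)\<in>\<D>. \<Delta> K) = g b - g a"
        unfolding \<Delta>_def by (rule additive_tagged_division_1[OF \<open>a \<le> b\<close> \<D>])
      then have "(\<Sum>(t,K)\<in>\<D>. measure lborel K *\<^sub>R k t) - (g b - g a) = (\<Sum>(t,K)\<in>\<D>. measure lborel K *\<^sub>R k t - \<Delta> K)"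
        by (simp add: case_prod_unfold sum_subtractf)
      also have "\<bar>\<dots>\<bar> \<le> (\<Sum>(t,K)\<in>\<D>. \<bar>measure lborel K *\<^sub>R k t - \<Delta> K\<bar>)"
        using sum_abs[of "\<lambda>(t,K). measure lborel K *\<^sub>R k t - \<Delta> K" \<D>] by (simp add: case_prod_unfold)
      also have "\<dots> < e"
        using good bad sum.subset_diff[OF sub fin, of "\<lambda>(t,K). \<bar>measure lborel K *\<^sub>R k t - \<Delta> K\<bar>"] by linarith
      finally show "norm ((\<Sum>(t, K)\<in>\<D>. measure lborel K *\<^sub>R k t) - (g b - g a)) < e"
        by simp
    qed
  qed
  then show ?thesis
    by (rule has_integral_spike[OF N, rotated]) (simp add: k_def)
qed

section \<open>Primitives and Cesaro means\<close>

lemma continuous_on_halflineI: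
  fixes g :: "real \<Rightarrow> real"
  assumes "\<And>T. continuous_on {0..T} g"
  shows "continuous_on {0..} g"
  unfolding continuous_on_eq_continuous_within
proof
  fix t :: real assume t: "t \<in> {0..}"
  have "at t within {0..} = at t within {0..t + 1}"
    by (rule at_within_nhd[of _ "{..<t + 1}"]) auto
  moreover have "continuous (at t within {0..t + 1}) g"
    using assms[of "t + 1"] t by (simp add: continuous_on_eq_continuous_within)
  ultimately show "continuous (at t within {0..}) g"
    by (simp add: continuous_def)
qed

lemma L1_loc_halflineI:
  assumes "\<And>T. set_integrable lebesgue {0..T} g"
  shows "g \<in> L1_loc"
  unfolding L1_loc_def
proof (intro CollectI allI impI, elim conjE)
  fix K :: "real set" assume K: "compact K" "K \<subseteq> {0..}"
  obtain T where "\<And>x. x \<in> K \<Longrightarrow> \<bar>x\<bar> \<le> T"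
    using compact_imp_bounded[OF K(1)] by (auto simp: bounded_iff)
  then have "K \<subseteq> {0..T}" using K(2) by fastforce
  moreover have "K \<in> sets lebesgue"
    using K(1) by (simp add: borel_compact sets_completionI_sets)
  ultimately show "set_integrable lebesgue K g"
    using set_integrable_subset[OF assms[of T]] by blast
qed

lemma L1_loc_integrable:
  assumes "g \<in> L1_loc" "0 \<le> a"
  shows "set_integrable lebesgue {a..b} g" "g integrable_on {a..b}"
    "(LINT s:{a..b}|lebesgue. g s) = integral {a..b} g"
proof -
  show *: "set_integrable lebesgue {a..b} g"
    using assms unfolding L1_loc_def by auto
  show "g integrable_on {a..b}" "(LINT s:{a..b}|lebesgue. g s) = integral {a..b} g"
    using set_lebesgue_integral_eq_integral[OF *] by auto
qed

lemma continuous_L1_loc: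
  assumes "continuous_on {0..} g"
  shows "g \<in> L1_loc"
  by (intro L1_loc_halflineI absolutely_integrable_continuous_real continuous_on_subset[OF assms]) auto

lemma primitive_continuous:
  assumes "g \<in> L1_loc"
  shows "continuous_on {0..} (\<lambda>t. integral {0..t} g)"
  by (intro continuous_on_halflineI indefinite_integral_continuous_1 L1_loc_integrable assms) auto

lemma primitive_increment:
  assumes "g \<in> L1_loc" "0 \<le> s" "0 \<le> \<theta>"
  shows "integral {s..s + \<theta>} g = integral {0..s + \<theta>} g - integral {0..s} g"
  using Henstock_Kurzweil_Integration.integral_combine[of 0 s "s + \<theta>" g]
    L1_loc_integrable(2)[OF assms(1), of 0 "s + \<theta>"] assms by simp

text \<open>Gauge integrals over \<open>{0..t}\<close> take the place of the Lebesgue integrals in the definitions from here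
  on; the two agree for locally integrable functions.\<close>

lemma mem_Ces_iff:
  "g \<in> Ces \<longleftrightarrow> g \<in> L1_loc \<and> (\<exists>C. ((\<lambda>t. integral {0..t} g / t) \<longlongrightarrow> C) at_top)"
  and cesaro_mean_tendsto_iff:
  "g \<in> L1_loc \<Longrightarrow> (cesaro_mean g \<longlongrightarrow> C) at_top \<longleftrightarrow> ((\<lambda>t. integral {0..t} g / t) \<longlongrightarrow> C) at_top"
proof -
  show *: "(cesaro_mean g \<longlongrightarrow> C) at_top \<longleftrightarrow> ((\<lambda>t. integral {0..t} g / t) \<longlongrightarrow> C) at_top"
    if "g \<in> L1_loc" for C
  proof -
    have "cesaro_mean g = (\<lambda>t. integral {0..t} g / t)"
      by (rule ext) (simp add: cesaro_mean_def L1_loc_integrable(3)[OF that order_refl])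
    then show ?thesis by simp
  qed
  show "g \<in> Ces \<longleftrightarrow> g \<in> L1_loc \<and> (\<exists>C. ((\<lambda>t. integral {0..t} g / t) \<longlongrightarrow> C) at_top)"
    using * by (auto simp: Ces_def)
qed

lemma integral_shifted:
  fixes g :: "real \<Rightarrow> real"
  assumes "continuous_on {0..} g" "0 \<le> \<theta>" "0 \<le> t"
  shows "integral {0..t} (\<lambda>s. g (s + \<theta>)) = integral {0..t + \<theta>} g - integral {0..\<theta>} g"
proof -
  have "integral {0..t} (g \<circ> (\<lambda>s. s + \<theta>)) = integral {0 + \<theta>..t + \<theta>} g"
    by (rule integral_shift) (rule continuous_on_subset[OF assms(1)], use assms in auto)
  also have "\<dots> = integral {0..t + \<theta>} g - integral {0..\<theta>} g"
    using primitive_increment[OF continuous_L1_loc[OF assms(1)] assms(2,3)] by (simp add: add.commute)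
  finally show ?thesis by (simp add: o_def)
qed

lemma continuous_on_shifted:
  fixes g :: "real \<Rightarrow> real"
  assumes "continuous_on {0..} g" "0 \<le> \<theta>"
  shows "continuous_on {0..} (\<lambda>s. g (s + \<theta>))"
  by (rule continuous_on_compose2[OF assms(1)]) (use assms(2) in \<open>auto intro!: continuous_intros\<close>)

lemma integral_increments:
  fixes g :: "real \<Rightarrow> real"
  assumes "continuous_on {0..} g" "0 \<le> \<theta>" "0 \<le> t"
  shows "integral {0..t} (\<lambda>s. g (s + \<theta>) - g s)
    = integral {0..t + \<theta>} g - integral {0..\<theta>} g - integral {0..t} g"
  using L1_loc_integrable(2)[OF continuous_L1_loc[OF continuous_on_shifted[OF assms(1,2)]], of 0 t]
    L1_loc_integrable(2)[OF continuous_L1_loc[OF assms(1)], of 0 t]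
  by (simp add: Henstock_Kurzweil_Integration.integral_diff integral_shifted[OF assms])

text \<open>The integrand is minus the average of \<open>F (s + \<theta>) - F s\<close> over \<open>0 \<le> \<theta> \<le> 1\<close>; exchanging the two
  integrations turns its primitive into an average of increments of \<open>G\<close>.\<close>

lemma integral_minus_moving_average:
  fixes F :: "real \<Rightarrow> real"
  assumes F: "continuous_on {0..} F" and t: "0 \<le> t"
  defines "G \<equiv> \<lambda>t. integral {0..t} F"
  shows "integral {0..t} (\<lambda>s. F s - (G (s + 1) - G s)) = - integral {0..1} (\<lambda>\<theta>. G (t + \<theta>) - G \<theta> - G t)"
proof -
  have int: "(\<lambda>\<theta>. F (s + \<theta>)) integrable_on {0..1}" if "s \<in> {0..t}" for s
    using that continuous_on_shifted[OF F, of s]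
    by (intro integrable_continuous_real) (auto simp: add.commute intro: continuous_on_subset)
  have "F s - (G (s + 1) - G s) = - integral {0..1} (\<lambda>\<theta>. F (s + \<theta>) - F s)" if "s \<in> {0..t}" for s
  proof -
    have "integral {0..1} (\<lambda>\<theta>. F (s + \<theta>) - F s) = integral {0..1} (\<lambda>\<theta>. F (s + \<theta>)) - F s"
      by (subst Henstock_Kurzweil_Integration.integral_diff[OF int[OF that]]) auto
    then show ?thesis
      using integral_shifted[OF F, of s 1] that by (simp add: G_def add.commute)
  qed
  then have "integral {0..t} (\<lambda>s. F s - (G (s + 1) - G s))
      = integral {0..t} (\<lambda>s. - integral {0..1} (\<lambda>\<theta>. F (s + \<theta>) - F s))"
    by (intro Henstock_Kurzweil_Integration.integral_cong)
  also have "\<dots> = - integral (cbox 0 t) (\<lambda>s. integral (cbox 0 1) (\<lambda>\<theta>. F (s + \<theta>) - F s))"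
    by simp
  also have "integral (cbox 0 t) (\<lambda>s. integral (cbox 0 1) (\<lambda>\<theta>. F (s + \<theta>) - F s))
      = integral (cbox 0 1) (\<lambda>\<theta>. integral (cbox 0 t) (\<lambda>s. F (s + \<theta>) - F s))"
    by (rule integral_swap_continuous)
       (auto simp: case_prod_unfold cbox_Pair_eq intro!: continuous_intros continuous_on_compose2[OF F])
  also have "\<dots> = integral {0..1} (\<lambda>\<theta>. G (t + \<theta>) - G \<theta> - G t)"
    by (auto simp: G_def integral_increments[OF F _ t] intro!: Henstock_Kurzweil_Integration.integral_cong)
  finally show ?thesis .
qed

section \<open>Slopes of increments\<close>

text \<open>Pointwise convergence on \<open>{0..1}\<close> already gives a uniform linear bound on the increments. The
  closed sets \<open>E k\<close> of those \<open>\<theta>\<close> at which the bound \<open>k * t\<close> holds cover \<open>{0..1}\<close>, so by Baire's theorem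
  one of them contains an interval \<open>{a..b}\<close>. Subtracting the increment by \<open>a\<close> gives a bound for all
  increments of length at most \<open>b - a\<close>, and finitely many such steps reach length 1.\<close>

lemma increments_locally_bounded:
  fixes G c :: "real \<Rightarrow> real"
  assumes cont: "continuous_on {0..} G"
    and lim: "\<And>\<theta>. \<theta> \<in> {0..1} \<Longrightarrow> ((\<lambda>t. (G (t + \<theta>) - G t) / t) \<longlongrightarrow> c \<theta>) at_top"
  shows "\<exists>K. \<forall>t\<ge>2. \<forall>\<theta>\<in>{0..1}. \<bar>G (t + \<theta>) - G t\<bar> \<le> K * t"
proof -
  define E where "E k = {\<theta> \<in> {0..1}. \<forall>t\<ge>1. \<bar>G (t + \<theta>) - G t\<bar> \<le> real k * t}" for k
  have cont_G: "continuous_on S (\<lambda>z. G (p z))" if "continuous_on S p" "\<And>z. z \<in> S \<Longrightarrow> p z \<ge> 0"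
    for S :: "real set" and p
    by (rule continuous_on_compose2[OF cont that(1)]) (use that(2) in auto)
  have closed: "closed (E k)" for k
  proof -
    have "E k = (\<Inter>t\<in>{1..}. {\<theta> \<in> {0..1}. \<bar>G (t + \<theta>) - G t\<bar> \<le> real k * t})"
      by (auto simp: E_def)
    also have "closed \<dots>"
      by (intro closed_INT ballI continuous_on_closed_Collect_le
          continuous_intros cont_G) auto
    finally show ?thesis .
  qed
  have cover: "{0..1} \<subseteq> (\<Union>k. E k)"
  proof
    fix \<theta> :: real assume \<theta>: "\<theta> \<in> {0..1}"
    have "\<forall>\<^sub>F t in at_top. dist ((G (t + \<theta>) - G t) / t) (c \<theta>) < 1"
      using lim[OF \<theta>] by (rule tendstoD) simp
    then obtain T where T: "\<And>t. t \<ge> T \<Longrightarrow> dist ((G (t + \<theta>) - G t) / t) (c \<theta>) < 1"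
      by (auto simp: eventually_at_top_linorder)
    have "bounded ((\<lambda>t. G (t + \<theta>) - G t) ` {1..T})"
      using \<theta> by (intro compact_imp_bounded compact_continuous_image continuous_intros cont_G) auto
    then obtain B where B: "B > 0" "\<And>t. t \<in> {1..T} \<Longrightarrow> \<bar>G (t + \<theta>) - G t\<bar> \<le> B"
      unfolding bounded_pos by auto
    obtain k :: nat where k: "real k \<ge> max B (\<bar>c \<theta>\<bar> + 1)"
      using real_arch_simple by blast
    have "\<bar>G (t + \<theta>) - G t\<bar> \<le> real k * t" if "t \<ge> 1" for t
    proof (cases "t \<le> T")
      case True
      have "B * 1 \<le> real k * t" using that k B by (intro mult_mono) auto
      then show ?thesis using B(2)[of t] True that by simp
    next
      case False
      then have "\<bar>(G (t + \<theta>) - G t) / t - c \<theta>\<bar> < 1" using T[of t] by (simp add: dist_real_def)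
      then have "\<bar>(G (t + \<theta>) - G t) / t\<bar> \<le> real k" using k by linarith
      then show ?thesis using that by (simp add: abs_divide pos_divide_le_eq)
    qed
    then show "\<theta> \<in> (\<Union>k. E k)" using \<theta> by (auto simp: E_def)
  qed
  have "\<exists>k. \<not> {0..1} \<subseteq> closure ({0..1} - E k)"
  proof (rule ccontr)
    assume "\<not> ?thesis"
    then have "{0..1} \<subseteq> closure (\<Inter> (range (\<lambda>k. {0..1::real} - E k)))"
    proof (intro Baire)
      fix U assume "U \<in> range (\<lambda>k. {0..1} - E k)"
      then obtain k where "U = {0..1} \<inter> - E k" by auto
      then show "openin (top_of_set {0..1}) U \<and> {0..1} \<subseteq> closure U"
        using closed[of k] \<open>\<not> (\<exists>k. \<not> {0..1} \<subseteq> closure ({0..1} - E k))\<close>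
        by (simp add: Diff_eq openin_open_Int open_Compl)
    qed auto
    moreover have "\<Inter> (range (\<lambda>k. {0..1::real} - E k)) = {}"
      using cover by blast
    ultimately show False
      by (metis atLeastAtMost_iff closure_empty empty_iff order_refl subsetD zero_le_one)
  qed
  then obtain k x where x: "x \<in> {0..1}" "x \<notin> closure ({0..1} - E k)"
    by blast
  then obtain e where e: "e > 0" "\<And>y. y \<in> {0..1} - E k \<Longrightarrow> e \<le> dist y x"
    unfolding closure_approachable by (meson not_le)
  define a b where "a = max 0 (x - e / 2)" and "b = min 1 (x + e / 2)"
  have ab: "0 \<le> a" "a < b" "b \<le> 1" using x(1) e(1) by (auto simp: a_def b_def)
  have in_E: "\<theta> \<in> E k" if "\<theta> \<in> {a..b}" for \<theta>
  proof (rule ccontr)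
    assume "\<theta> \<notin> E k"
    then have "e \<le> dist \<theta> x" using that ab by (intro e(2)) auto
    moreover have "\<bar>\<theta> - x\<bar> \<le> e / 2" using that unfolding a_def b_def by (auto simp: abs_if)
    ultimately show False using e(1) by (simp add: dist_real_def)
  qed
  define \<delta> where "\<delta> = b - a"
  have "\<delta> > 0" using ab by (simp add: \<delta>_def)
  have short: "\<bar>G (s + \<eta>) - G s\<bar> \<le> 2 * real k * s" if "s \<ge> 2" "0 \<le> \<eta>" "\<eta> \<le> \<delta>" for s \<eta> :: real
  proof -
    have t: "s - a \<ge> 1" using that ab by auto
    have E: "\<bar>G (s - a + \<theta>) - G (s - a)\<bar> \<le> real k * (s - a)" if "\<theta> \<in> E k" for \<theta>
      using that t unfolding E_def by blast
    have "\<bar>G (s - a + (a + \<eta>)) - G (s - a)\<bar> \<le> real k * (s - a)"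
      using that by (intro E in_E) (simp add: \<delta>_def)
    moreover have "\<bar>G (s - a + a) - G (s - a)\<bar> \<le> real k * (s - a)"
      using ab by (intro E in_E) simp
    moreover have "real k * (s - a) \<le> real k * s"
      using ab by (intro mult_left_mono) auto
    ultimately show ?thesis by (simp add: algebra_simps)
  qed
  have chain: "\<bar>G (s + \<eta>) - G s\<bar> \<le> n * (2 * real k * (s + 1))"
    if "s \<ge> 2" "0 \<le> \<eta>" "\<eta> \<le> n * \<delta>" "\<eta> \<le> 1" for n :: nat and s \<eta> :: real
    using that
  proof (induction n arbitrary: \<eta>)
    case 0
    then show ?case by simp
  next
    case (Suc n)
    define \<eta>' where "\<eta>' = max 0 (\<eta> - \<delta>)"
    have \<eta>': "0 \<le> \<eta>'" "\<eta>' \<le> n * \<delta>" "\<eta>' \<le> 1" "0 \<le> \<eta> - \<eta>'" "\<eta> - \<eta>' \<le> \<delta>"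
      using Suc.prems \<open>\<delta> > 0\<close> by (auto simp: \<eta>'_def algebra_simps)
    have "\<bar>G (s + \<eta>' + (\<eta> - \<eta>')) - G (s + \<eta>')\<bar> \<le> 2 * real k * (s + \<eta>')"
      using \<eta>' Suc.prems by (intro short) auto
    also have "\<dots> \<le> 2 * real k * (s + 1)"
      using \<eta>' by (intro mult_left_mono) auto
    finally have "\<bar>G (s + \<eta>) - G (s + \<eta>')\<bar> \<le> 2 * real k * (s + 1)" by simp
    moreover have "\<bar>G (s + \<eta>') - G s\<bar> \<le> n * (2 * real k * (s + 1))"
      using \<eta>' Suc.prems by (intro Suc.IH) auto
    moreover have "real (Suc n) * (2 * real k * (s + 1)) = n * (2 * real k * (s + 1)) + 2 * real k * (s + 1)"
      by (simp add: algebra_simps)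
    ultimately show ?case by linarith
  qed
  obtain n :: nat where n: "1 < n * \<delta>"
    using reals_Archimedean3[OF \<open>\<delta> > 0\<close>] by blast
  have "\<bar>G (t + \<theta>) - G t\<bar> \<le> (real n * (4 * real k)) * t" if "t \<ge> 2" "\<theta> \<in> {0..1}" for t \<theta>
  proof -
    have "\<bar>G (t + \<theta>) - G t\<bar> \<le> n * (2 * real k * (t + 1))"
      using that n by (intro chain) auto
    also have "\<dots> \<le> n * (2 * real k * (2 * t))"
      using that by (intro mult_left_mono) auto
    finally show ?thesis by simp
  qed
  then show ?thesis by blast
qed

text \<open>Dominated convergence, with the linear bound on the increments as majorant.\<close>

lemma averaged_increment_slope:
  fixes G c :: "real \<Rightarrow> real"
  assumes cont: "continuous_on {0..} G"
    and lim: "\<And>\<theta>. \<theta> \<in> {0..1} \<Longrightarrow> ((\<lambda>t. (G (t + \<theta>) - G t) / t) \<longlongrightarrow> c \<theta>) at_top"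
    and K: "\<And>t \<theta>. t \<ge> 2 \<Longrightarrow> \<theta> \<in> {0..1} \<Longrightarrow> \<bar>G (t + \<theta>) - G t\<bar> \<le> K * t"
  shows "\<exists>d. ((\<lambda>t. integral {0..1} (\<lambda>\<theta>. G (t + \<theta>) - G t) / t) \<longlongrightarrow> d) at_top"
proof -
  define q where "q t \<theta> = indicator {0..1} \<theta> * ((G (t + \<theta>) - G t) / t)" for t \<theta> :: real
  \<comment> \<open>Dominated convergence asks for measurability at every \<open>t\<close>, but \<open>G\<close> is only controlled on \<open>{0..}\<close>.\<close>
  define q' where "q' t = q (max 0 t)" for t
  have cont_t: "continuous_on {0..1} (\<lambda>\<theta>. (G (t + \<theta>) - G t) / t)" if "t \<ge> 0" for t
    using continuous_on_shifted[OF cont that]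
    by (cases "t = 0") (auto simp: add.commute intro!: continuous_intros intro: continuous_on_subset)
  have meas: "q' t \<in> borel_measurable lborel" for t
    using borel_measurable_continuous_on_indicator[OF _ cont_t[of "max 0 t"]]
    by (simp add: q'_def q_def[abs_def])
  have conv: "((\<lambda>t. q' t \<theta>) \<longlongrightarrow> indicator {0..1} \<theta> * c \<theta>) at_top" for \<theta>
  proof (rule Lim_transform_eventually)
    show "\<forall>\<^sub>F t in at_top. q t \<theta> = q' t \<theta>"
      using eventually_ge_at_top[of 0] by eventually_elim (simp add: q'_def max_def)
    show "((\<lambda>t. q t \<theta>) \<longlongrightarrow> indicator {0..1} \<theta> * c \<theta>) at_top"
      using lim[of \<theta>] unfolding q_def by (cases "\<theta> \<in> {0..1}") (auto simp: indicator_def)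
  qed
  have "((\<lambda>t. LINT \<theta>|lborel. q' t \<theta>) \<longlongrightarrow> (LINT \<theta>|lborel. indicator {0..1} \<theta> * c \<theta>)) at_top"
  proof (rule integral_dominated_convergence_at_top[where w = "\<lambda>\<theta>. \<bar>K\<bar> * indicator {0..1} \<theta>"])
    show "(\<lambda>\<theta>. indicator {0..1} \<theta> * c \<theta>) \<in> borel_measurable lborel"
    proof (rule borel_measurable_LIMSEQ_real)
      show "(\<lambda>n. q' (real n) \<theta>) \<longlonglongrightarrow> indicator {0..1} \<theta> * c \<theta>" for \<theta>
        by (rule filterlim_compose[OF conv filterlim_real_sequentially])
    qed (rule meas)
    show "integrable lborel (\<lambda>\<theta>::real. \<bar>K\<bar> * indicator {0..1} \<theta>)"
      by (intro integrable_mult_right integrable_real_indicator) auto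
    show "AE \<theta> in lborel. ((\<lambda>t. q' t \<theta>) \<longlongrightarrow> indicator {0..1} \<theta> * c \<theta>) at_top"
      using conv by simp
    show "\<forall>\<^sub>F t in at_top. AE \<theta> in lborel. norm (q' t \<theta>) \<le> \<bar>K\<bar> * indicator {0..1} \<theta>"
      using eventually_ge_at_top[of 2]
    proof eventually_elim
      case (elim t)
      have "\<bar>(G (t + \<theta>) - G t) / t\<bar> \<le> \<bar>K\<bar>" if "\<theta> \<in> {0..1}" for \<theta>
      proof -
        have "\<bar>G (t + \<theta>) - G t\<bar> \<le> \<bar>K\<bar> * t"
          using K[OF elim that] elim mult_right_mono[OF abs_ge_self, of t K] by linarith
        then show ?thesis using elim by (simp add: abs_divide pos_divide_le_eq)
      qed
      then have "norm (q' t \<theta>) \<le> \<bar>K\<bar> * indicator {0..1} \<theta>" for \<theta>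
        using elim by (simp add: q'_def q_def max_def indicator_def)
      then show ?case by simp
    qed
  qed (rule meas)
  moreover have "(LINT \<theta>|lborel. q' t \<theta>) = integral {0..1} (\<lambda>\<theta>. G (t + \<theta>) - G t) / t" if "t \<ge> 0" for t
  proof -
    have "(LINT \<theta>|lborel. q' t \<theta>) = (LINT \<theta>:{0..1}|lborel. (G (t + \<theta>) - G t) / t)"
      using that by (simp add: q'_def q_def set_lebesgue_integral_def max_def)
    also have "\<dots> = integral {0..1} (\<lambda>\<theta>. (G (t + \<theta>) - G t) / t)"
      by (rule set_borel_integral_eq_integral(2)) (rule borel_integrable_atLeastAtMost'[OF cont_t[OF that]])
    finally show ?thesis by simp
  qed
  then have "\<forall>\<^sub>F t in at_top. (LINT \<theta>|lborel. q' t \<theta>) = integral {0..1} (\<lambda>\<theta>. G (t + \<theta>) - G t) / t"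
    using eventually_ge_at_top[of 0] by (rule eventually_mono[rotated])
  ultimately show ?thesis
    by (intro exI) (rule Lim_transform_eventually)
qed

text \<open>Only the ratio of the arguments matters for slopes, and \<open>p t / t\<close> tends to 1.\<close>

lemma shifted_slope:
  fixes g :: "real \<Rightarrow> real"
  assumes "((\<lambda>t. g t / t) \<longlongrightarrow> L) at_top"
    and "\<And>t. t \<ge> 0 \<Longrightarrow> t \<le> p t \<and> p t \<le> t + \<theta>"
  shows "((\<lambda>t. g (p t) / t) \<longlongrightarrow> L) at_top"
proof -
  have "filterlim p at_top at_top"
  proof (rule filterlim_at_top_mono[OF filterlim_ident])
    show "\<forall>\<^sub>F t in at_top. t \<le> p t"
      using eventually_ge_at_top[of 0] by eventually_elim (use assms(2) in auto)
  qed
  then have "((\<lambda>t. g (p t) / p t) \<longlongrightarrow> L) at_top"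
    by (rule filterlim_compose[OF assms(1)])
  moreover have "((\<lambda>t. p t / t) \<longlongrightarrow> 1) at_top"
  proof (rule tendsto_sandwich)
    show "\<forall>\<^sub>F t in at_top. 1 \<le> p t / t"
      using eventually_gt_at_top[of 0] by eventually_elim (use assms(2) in \<open>simp add: field_simps\<close>)
    show "\<forall>\<^sub>F t in at_top. p t / t \<le> 1 + \<theta> / t"
      using eventually_gt_at_top[of 0] by eventually_elim (use assms(2) in \<open>simp add: field_simps\<close>)
    have "((\<lambda>t. 1 + \<theta> / t) \<longlongrightarrow> 1 + 0) at_top"
      by (intro tendsto_add tendsto_const tendsto_divide_0[OF tendsto_const]
          filterlim_at_top_imp_at_infinity filterlim_ident)
    then show "((\<lambda>t. 1 + \<theta> / t) \<longlongrightarrow> 1) at_top" by simp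
  qed simp
  ultimately have "((\<lambda>t. g (p t) / p t * (p t / t)) \<longlongrightarrow> L * 1) at_top"
    by (rule tendsto_mult)
  then have "((\<lambda>t. g (p t) / p t * (p t / t)) \<longlongrightarrow> L) at_top"
    by simp
  moreover have "\<forall>\<^sub>F t in at_top. g (p t) / p t * (p t / t) = g (p t) / t"
    using eventually_gt_at_top[of 0]
  proof eventually_elim
    case (elim t)
    then have "p t > 0" using assms(2)[of t] by simp
    then show ?case by simp
  qed
  ultimately show ?thesis
    by (rule Lim_transform_eventually)
qed

text \<open>By the mean value theorem the increment is \<open>\<theta>\<close> times a value of \<open>g\<close> at a point of \<open>{t..t + \<theta>}\<close>.\<close>

lemma increment_of_primitive_slope:
  fixes g :: "real \<Rightarrow> real"
  assumes cont: "continuous_on {0..} g" and L: "((\<lambda>t. g t / t) \<longlongrightarrow> L) at_top" and "\<theta> > 0"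
  shows "((\<lambda>t. (integral {0..t + \<theta>} g - integral {0..t} g) / t) \<longlongrightarrow> L * \<theta>) at_top"
proof -
  have "\<exists>u. t \<le> u \<and> u \<le> t + \<theta> \<and> integral {0..t + \<theta>} g - integral {0..t} g = g u * \<theta>" if "t \<ge> 0" for t
  proof -
    have "\<exists>u\<in>{t<..<t + \<theta>}. integral {0..t + \<theta>} g - integral {0..t} g = g u * (t + \<theta> - t)"
    proof (rule mvt_simple)
      fix u assume u: "t \<le> u" "u \<le> t + \<theta>"
      have "((\<lambda>u. integral {0..u} g) has_real_derivative g u) (at u within {0..t + \<theta>})"
        using u that by (intro integral_has_real_derivative continuous_on_subset[OF cont]) auto
      then have "((\<lambda>u. integral {0..u} g) has_real_derivative g u) (at u within {t..t + \<theta>})"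
        by (rule has_field_derivative_subset) (use that in auto)
      then show "((\<lambda>u. integral {0..u} g) has_derivative (*) (g u)) (at u within {t..t + \<theta>})"
        by (simp add: has_field_derivative_def)
    qed (use \<open>\<theta> > 0\<close> in auto)
    then obtain u where "t < u" "u < t + \<theta>"
      "integral {0..t + \<theta>} g - integral {0..t} g = g u * \<theta>"
      by auto
    then show ?thesis by (intro exI[of _ u]) simp
  qed
  then obtain p where p: "\<And>t. t \<ge> 0 \<Longrightarrow> t \<le> p t \<and> p t \<le> t + \<theta>"
    and eq: "\<And>t. t \<ge> 0 \<Longrightarrow> integral {0..t + \<theta>} g - integral {0..t} g = g (p t) * \<theta>"
    by metis
  have "((\<lambda>t. g (p t) / t * \<theta>) \<longlongrightarrow> L * \<theta>) at_top"
    by (intro tendsto_mult tendsto_const shifted_slope[OF L p])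
  moreover have "\<forall>\<^sub>F t in at_top. g (p t) / t * \<theta> = (integral {0..t + \<theta>} g - integral {0..t} g) / t"
    using eventually_ge_at_top[of 0] by eventually_elim (simp add: eq)
  ultimately show ?thesis
    by (rule Lim_transform_eventually)
qed

section \<open>Convolution of causal functions\<close>

text \<open>The functions on which convolutions act: they vanish on the negative axis, so that integrals over
  \<open>{0..t}\<close> become integrals over the whole line and no domain of integration has to be carried along.\<close>

definition causal :: "(real \<Rightarrow> real) \<Rightarrow> bool" where
  "causal g \<longleftrightarrow> g \<in> borel_measurable borel \<and> (\<forall>t<0. g t = 0) \<and> (\<forall>T. \<exists>B. \<forall>t\<le>T. \<bar>g t\<bar> \<le> B)"

text \<open>A kernel is a density \<open>k\<close> against a measure \<open>\<mu>\<close>. This covers convolution with a finite measure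
  (density 1), with a locally bounded function and, for the indicator of \<open>{0..}\<close>, integration
  (\<open>\<mu>\<close> the Lebesgue measure). The \<open>\<sigma>\<close>-algebra of \<open>\<mu>\<close> is fixed only up to measurability of the
  identity, since the measures in question may live on \<open>{0..}\<close> only.\<close>

definition conv_kernel :: "real measure \<Rightarrow> (real \<Rightarrow> real) \<Rightarrow> bool" where
  "conv_kernel \<mu> k \<longleftrightarrow> sigma_finite_measure \<mu> \<and> (\<lambda>s. s) \<in> borel_measurable \<mu> \<and> k \<in> borel_measurable \<mu> \<and>
     (\<forall>s\<in>space \<mu>. s < 0 \<longrightarrow> k s = 0) \<and> (\<forall>T. integrable \<mu> (\<lambda>s. indicator {..T} s * k s))"

definition conv :: "real measure \<Rightarrow> (real \<Rightarrow> real) \<Rightarrow> (real \<Rightarrow> real) \<Rightarrow> real \<Rightarrow> real" where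
  "conv \<mu> k g t = (LINT s|\<mu>. k s * g (t - s))"

lemma causal_measurable: "causal g \<Longrightarrow> g \<in> borel_measurable borel"
  by (simp add: causal_def)

lemma causal_negative: "causal g \<Longrightarrow> t < 0 \<Longrightarrow> g t = 0"
  by (simp add: causal_def)

lemma causal_boundE:
  assumes "causal g"
  obtains B where "B \<ge> 0" "\<And>t. t \<le> T \<Longrightarrow> \<bar>g t\<bar> \<le> B"
proof -
  obtain B where "\<And>t. t \<le> T \<Longrightarrow> \<bar>g t\<bar> \<le> B"
    using assms unfolding causal_def by blast
  then have "\<And>t. t \<le> T \<Longrightarrow> \<bar>g t\<bar> \<le> \<bar>B\<bar>"
    by (meson abs_ge_self order_trans)
  then show thesis
    by (rule that[OF abs_ge_zero[of B]])
qed

lemma causal_add: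
  assumes "causal g" "causal h"
  shows "causal (\<lambda>t. g t + h t)"
proof -
  have "\<exists>B. \<forall>t\<le>T. \<bar>g t + h t\<bar> \<le> B" for T
  proof -
    obtain B where B: "\<And>t. t \<le> T \<Longrightarrow> \<bar>g t\<bar> \<le> B"
      using causal_boundE[OF assms(1)] by blast
    obtain C where C: "\<And>t. t \<le> T \<Longrightarrow> \<bar>h t\<bar> \<le> C"
      using causal_boundE[OF assms(2)] by blast
    have "\<bar>g t + h t\<bar> \<le> B + C" if "t \<le> T" for t
      using B[OF that] C[OF that] by linarith
    then show ?thesis by blast
  qed
  then show ?thesis
    using assms by (auto simp: causal_def)
qed

lemma causal_cmult:
  assumes "causal g"
  shows "causal (\<lambda>t. c * g t)"
proof -
  have "\<exists>B. \<forall>t\<le>T. \<bar>c * g t\<bar> \<le> B" for T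
  proof -
    obtain B where "\<And>t. t \<le> T \<Longrightarrow> \<bar>g t\<bar> \<le> B"
      using causal_boundE[OF assms] by blast
    then have "\<bar>c * g t\<bar> \<le> \<bar>c\<bar> * B" if "t \<le> T" for t
      using that by (simp add: abs_mult mult_left_mono)
    then show ?thesis by blast
  qed
  then show ?thesis
    using assms by (auto simp: causal_def)
qed

lemma causal_diff:
  assumes "causal g" "causal h"
  shows "causal (\<lambda>t. g t - h t)"
  using causal_add[OF assms(1) causal_cmult[OF assms(2), of "-1"]] by simp

lemma causal_continuous:
  assumes "continuous_on {0..} g"
  shows "causal (\<lambda>t. indicator {0..} t * g t)"
proof -
  have "\<exists>B. \<forall>t\<le>T. \<bar>indicator {0..} t * g t\<bar> \<le> B" for T
  proof -
    have "bounded (g ` {0..T})"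
      using assms by (intro compact_imp_bounded compact_continuous_image)
        (auto intro: continuous_on_subset)
    then obtain B where "B > 0" "\<And>t. 0 \<le> t \<Longrightarrow> t \<le> T \<Longrightarrow> \<bar>g t\<bar> \<le> B"
      unfolding bounded_pos by auto
    then show ?thesis by (intro exI[of _ B]) (auto simp: indicator_def)
  qed
  moreover have "(\<lambda>t. indicator {0..} t * g t) \<in> borel_measurable borel"
    using borel_measurable_continuous_on_indicator[OF _ assms] by simp
  ultimately show ?thesis
    by (auto simp: causal_def)
qed

lemma causal_unit: "causal (indicator {0..})"
  using causal_continuous[of "\<lambda>_. 1"] by simp

lemma conv_integrable:
  assumes k: "conv_kernel \<mu> k" and g: "causal g"
  shows "integrable \<mu> (\<lambda>s. k s * g (t - s))"
proof -
  obtain B where "B \<ge> 0" and B: "\<And>s. s \<le> t \<Longrightarrow> \<bar>g s\<bar> \<le> B"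
    using causal_boundE[OF g] by blast
  have [measurable]: "k \<in> borel_measurable \<mu>" "(\<lambda>s. s) \<in> borel_measurable \<mu>" "g \<in> borel_measurable borel"
    using k g by (auto simp: conv_kernel_def causal_def)
  have "integrable \<mu> (\<lambda>s. B * (indicator {..t} s * k s))"
    using k by (intro integrable_mult_right) (simp add: conv_kernel_def)
  then show ?thesis
  proof (rule Bochner_Integration.integrable_bound)
    show "(\<lambda>s. k s * g (t - s)) \<in> borel_measurable \<mu>" by measurable
    have "norm (k s * g (t - s)) \<le> norm (B * (indicator {..t} s * k s))" if "s \<in> space \<mu>" for s
    proof (cases "0 \<le> s \<and> s \<le> t")
      case True
      have "\<bar>k s\<bar> * \<bar>g (t - s)\<bar> \<le> \<bar>k s\<bar> * B"
        using True by (intro mult_left_mono B) auto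
      then show ?thesis using True \<open>B \<ge> 0\<close> by (simp add: abs_mult mult.commute)
    next
      case False
      then have "k s = 0 \<or> g (t - s) = 0"
        using k that causal_negative[OF g, of "t - s"] by (auto simp: conv_kernel_def not_le)
      then show ?thesis by auto
    qed
    then show "AE s in \<mu>. norm (k s * g (t - s)) \<le> norm (B * (indicator {..t} s * k s))"
      by simp
  qed
qed

lemma causal_conv:
  assumes k: "conv_kernel \<mu> k" and g: "causal g"
  shows "causal (conv \<mu> k g)"
proof -
  interpret sigma_finite_measure \<mu> using k by (simp add: conv_kernel_def)
  have [measurable]: "k \<in> borel_measurable \<mu>" "(\<lambda>s. s) \<in> borel_measurable \<mu>" "g \<in> borel_measurable borel"
    using k g by (auto simp: conv_kernel_def causal_def)
  have "conv \<mu> k g \<in> borel_measurable borel"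
    unfolding conv_def by measurable
  moreover have "conv \<mu> k g t = 0" if "t < 0" for t
  proof -
    have "k s * g (t - s) = 0" if "s \<in> space \<mu>" for s
      using k that \<open>t < 0\<close> causal_negative[OF g, of "t - s"]
      by (cases "s < 0") (auto simp: conv_kernel_def)
    then have "conv \<mu> k g t = (LINT s|\<mu>. 0)"
      unfolding conv_def by (intro Bochner_Integration.integral_cong) auto
    then show ?thesis by simp
  qed
  moreover have "\<exists>B. \<forall>t\<le>T. \<bar>conv \<mu> k g t\<bar> \<le> B" for T
  proof -
    obtain B where "B \<ge> 0" and B: "\<And>s. s \<le> T \<Longrightarrow> \<bar>g s\<bar> \<le> B"
      using causal_boundE[OF g] by blast
    let ?w = "\<lambda>s. \<bar>B * (indicator {..T} s * k s)\<bar>"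
    have w: "integrable \<mu> ?w"
      using k by (intro integrable_abs integrable_mult_right) (simp add: conv_kernel_def)
    have "\<bar>conv \<mu> k g t\<bar> \<le> (LINT s|\<mu>. ?w s)" if "t \<le> T" for t
    proof -
      have "\<bar>k s * g (t - s)\<bar> \<le> ?w s" if "s \<in> space \<mu>" for s
      proof (cases "0 \<le> s \<and> s \<le> t")
        case True
        have "\<bar>k s\<bar> * \<bar>g (t - s)\<bar> \<le> \<bar>k s\<bar> * B"
          using True \<open>t \<le> T\<close> by (intro mult_left_mono B) auto
        then show ?thesis using True \<open>B \<ge> 0\<close> \<open>t \<le> T\<close> by (simp add: abs_mult mult.commute)
      next
        case False
        then have "k s = 0 \<or> g (t - s) = 0"
          using k that causal_negative[OF g, of "t - s"] by (auto simp: conv_kernel_def not_le)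
        then show ?thesis by auto
      qed
      then have "(LINT s|\<mu>. \<bar>k s * g (t - s)\<bar>) \<le> (LINT s|\<mu>. ?w s)"
        using conv_integrable[OF k g] w by (intro integral_mono) auto
      then show ?thesis
        using integral_abs_bound[of \<mu> "\<lambda>s. k s * g (t - s)"] unfolding conv_def by linarith
    qed
    then show ?thesis by blast
  qed
  ultimately show ?thesis by (auto simp: causal_def)
qed

lemma conv_diff:
  assumes "conv_kernel \<mu> k" "causal g" "causal h"
  shows "conv \<mu> k (\<lambda>t. g t - h t) t = conv \<mu> k g t - conv \<mu> k h t"
  using conv_integrable[OF assms(1,2)] conv_integrable[OF assms(1,3)]
  by (simp add: conv_def right_diff_distrib)

lemma conv_add:
  assumes "conv_kernel \<mu> k" "causal g" "causal h"
  shows "conv \<mu> k (\<lambda>t. g t + h t) t = conv \<mu> k g t + conv \<mu> k h t"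
  using conv_integrable[OF assms(1,2)] conv_integrable[OF assms(1,3)]
  by (simp add: conv_def distrib_left)

lemma conv_cmult: "conv \<mu> k (\<lambda>t. c * g t) t = c * conv \<mu> k g t"
  by (simp add: conv_def mult.left_commute)

text \<open>Both sides are the double integral of \<open>k s * l u * g (t - s - u)\<close>. It vanishes unless \<open>s\<close> and \<open>u\<close> lie
  in \<open>{0..t}\<close>, so a multiple of the product of the truncated densities is an integrable majorant.\<close>

lemma conv_commute:
  assumes k: "conv_kernel \<mu> k" and l: "conv_kernel \<mu>' l" and g: "causal g"
  shows "conv \<mu> k (conv \<mu>' l g) t = conv \<mu>' l (conv \<mu> k g) t"
proof -
  interpret M1: sigma_finite_measure \<mu> using k by (simp add: conv_kernel_def)
  interpret M2: sigma_finite_measure \<mu>' using l by (simp add: conv_kernel_def)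
  interpret pair_sigma_finite \<mu> \<mu>' ..
  have [measurable]: "k \<in> borel_measurable \<mu>" "(\<lambda>s. s) \<in> borel_measurable \<mu>" "g \<in> borel_measurable borel"
     "l \<in> borel_measurable \<mu>'" "(\<lambda>s. s) \<in> borel_measurable \<mu>'"
    using k l g by (auto simp: conv_kernel_def causal_def)
  have [measurable]: "fst \<in> borel_measurable (\<mu> \<Otimes>\<^sub>M \<mu>')" "snd \<in> borel_measurable (\<mu> \<Otimes>\<^sub>M \<mu>')"
    using measurable_compose[OF measurable_fst, of "\<lambda>s. s" \<mu> borel \<mu>']
      measurable_compose[OF measurable_snd, of "\<lambda>s. s" \<mu>' borel \<mu>] by simp_all
  obtain B where "B \<ge> 0" and B: "\<And>s. s \<le> t \<Longrightarrow> \<bar>g s\<bar> \<le> B"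
    using causal_boundE[OF g] by blast
  let ?k = "\<lambda>s. indicator {..t} s * k s" and ?l = "\<lambda>u. indicator {..t} u * l u"
  have ik: "integrable \<mu> ?k" and il: "integrable \<mu>' ?l"
    using k l by (auto simp: conv_kernel_def)
  have [measurable]: "?k \<in> borel_measurable \<mu>" "?l \<in> borel_measurable \<mu>'"
    using ik il by auto
  have w: "integrable (\<mu> \<Otimes>\<^sub>M \<mu>') (\<lambda>(s, u). B * (?k s * ?l u))"
  proof (rule Fubini_integrable)
    show "(\<lambda>(s, u). B * (?k s * ?l u)) \<in> borel_measurable (\<mu> \<Otimes>\<^sub>M \<mu>')" by measurable
    have "integrable \<mu> (\<lambda>s. \<bar>?k s\<bar> * (\<bar>B\<bar> * (LINT u|\<mu>'. \<bar>?l u\<bar>)))"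
      using ik by (intro integrable_mult_left integrable_abs)
    moreover have "(LINT u|\<mu>'. norm (case (s, u) of (s, u) \<Rightarrow> B * (?k s * ?l u)))
        = \<bar>?k s\<bar> * (\<bar>B\<bar> * (LINT u|\<mu>'. \<bar>?l u\<bar>))" for s
    proof -
      have "norm (B * (?k s * ?l u)) = (\<bar>?k s\<bar> * \<bar>B\<bar>) * \<bar>?l u\<bar>" for u
        by (simp add: abs_mult)
      then show ?thesis by simp
    qed
    ultimately show "integrable \<mu> (\<lambda>s. LINT u|\<mu>'. norm (case (s, u) of (s, u) \<Rightarrow> B * (?k s * ?l u)))"
      by presburger
    show "AE s in \<mu>. integrable \<mu>' (\<lambda>u. case (s, u) of (s, u) \<Rightarrow> B * (?k s * ?l u))"
      using il by auto
  qed
  have "integrable (\<mu> \<Otimes>\<^sub>M \<mu>') (\<lambda>(s, u). k s * (l u * g (t - s - u)))"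
    using w
  proof (rule Bochner_Integration.integrable_bound)
    show "(\<lambda>(s, u). k s * (l u * g (t - s - u))) \<in> borel_measurable (\<mu> \<Otimes>\<^sub>M \<mu>')" by measurable
    have "\<bar>k s * (l u * g (t - s - u))\<bar> \<le> \<bar>B * (?k s * ?l u)\<bar>"
      if "s \<in> space \<mu>" "u \<in> space \<mu>'" for s u
    proof (cases "0 \<le> s \<and> 0 \<le> u \<and> s + u \<le> t")
      case True
      have "\<bar>k s * l u\<bar> * \<bar>g (t - s - u)\<bar> \<le> \<bar>k s * l u\<bar> * B"
        using True by (intro mult_left_mono B) auto
      then show ?thesis using True \<open>B \<ge> 0\<close> by (simp add: abs_mult ac_simps)
    next
      case False
      then have "k s = 0 \<or> l u = 0 \<or> g (t - s - u) = 0"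
        using k l that causal_negative[OF g, of "t - s - u"] by (auto simp: conv_kernel_def not_le)
      then show ?thesis by auto
    qed
    then show "AE p in \<mu> \<Otimes>\<^sub>M \<mu>'. norm (case p of (s, u) \<Rightarrow> k s * (l u * g (t - s - u)))
        \<le> norm (case p of (s, u) \<Rightarrow> B * (?k s * ?l u))"
      by (auto simp: space_pair_measure)
  qed
  from Fubini_integral[OF this]
  have "(LINT s|\<mu>. LINT u|\<mu>'. k s * (l u * g (t - s - u)))
      = (LINT u|\<mu>'. LINT s|\<mu>. k s * (l u * g (t - s - u)))" by simp
  also have "\<dots> = (LINT u|\<mu>'. LINT s|\<mu>. l u * (k s * g (t - u - s)))"
    by (simp add: ac_simps diff_diff_eq)
  finally show ?thesis
    by (simp add: conv_def)
qed

lemma conv_kernel_causal: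
  assumes k: "causal k"
  shows "conv_kernel lborel k"
proof -
  have [measurable]: "k \<in> borel_measurable borel" using k by (simp add: causal_def)
  have "integrable lborel (\<lambda>s. indicator {..T} s * k s)" for T
  proof -
    obtain B where "B \<ge> 0" and B: "\<And>s. s \<le> T \<Longrightarrow> \<bar>k s\<bar> \<le> B"
      using causal_boundE[OF k] by blast
    have "integrable lborel (\<lambda>s. B * indicator {0..T} s)"
      by (intro integrable_mult_right) (auto simp: emeasure_lborel_Icc_eq)
    then show ?thesis
    proof (rule Bochner_Integration.integrable_bound)
      show "(\<lambda>s. indicator {..T} s * k s) \<in> borel_measurable lborel" by measurable
      have "norm (indicator {..T} s * k s) \<le> norm (B * indicator {0..T} s)" for s
        using B[of s] causal_negative[OF k, of s] \<open>B \<ge> 0\<close> by (auto simp: indicator_def)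
      then show "AE s in lborel. norm (indicator {..T} s * k s) \<le> norm (B * indicator {0..T} s)"
        by simp
    qed
  qed
  then show ?thesis
    using k by (simp add: conv_kernel_def causal_def lborel.sigma_finite_measure_axioms)
qed

lemma conv_lborel_commute: "conv lborel g h t = conv lborel h g t"
  unfolding conv_def by (subst lborel_integral_real_affine[where c = "-1" and t = t]) (simp_all add: mult.commute)

lemma conv_unit:
  assumes "causal g"
  shows "conv lborel (indicator {0..}) g t = (LINT s:{0..t}|lborel. g s)"
proof -
  have "(\<lambda>s. g s * indicator {0..} (t - s)) = (\<lambda>s. indicator {0..t} s *\<^sub>R g s)"
    using causal_negative[OF assms] by (auto simp: indicator_def fun_eq_iff)
  then show ?thesis
    unfolding conv_lborel_commute[of "indicator {0..}" g] by (simp add: conv_def set_lebesgue_integral_def)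
qed

text \<open>For fixed \<open>s\<close> the quotient \<open>g (t - s) / t\<close> tends to \<open>L\<close>. A causal function with a slope grows at most
  linearly, so \<open>g (t - s) / t\<close> is bounded for \<open>t \<ge> 1\<close> and \<open>k\<close> provides an integrable majorant.\<close>

lemma conv_slope:
  assumes k: "conv_kernel \<mu> k" and int: "integrable \<mu> k" and g: "causal g"
    and L: "((\<lambda>t. g t / t) \<longlongrightarrow> L) at_top"
  shows "((\<lambda>t. conv \<mu> k g t / t) \<longlongrightarrow> L * (LINT s|\<mu>. k s)) at_top"
proof -
  have [measurable]: "k \<in> borel_measurable \<mu>" "(\<lambda>s. s) \<in> borel_measurable \<mu>" "g \<in> borel_measurable borel"
    using k g by (auto simp: conv_kernel_def causal_def)
  have "\<forall>\<^sub>F t in at_top. dist (g t / t) L < 1"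
    using L by (rule tendstoD) simp
  then obtain T0 where T0: "\<And>t. t \<ge> T0 \<Longrightarrow> dist (g t / t) L < 1"
    by (auto simp: eventually_at_top_linorder)
  obtain B where "B \<ge> 0" and B: "\<And>s. s \<le> max 1 T0 \<Longrightarrow> \<bar>g s\<bar> \<le> B"
    using causal_boundE[OF g] by blast
  have growth: "\<bar>g t\<bar> \<le> (\<bar>L\<bar> + 1) * t + B" if "t \<ge> 0" for t
  proof (cases "t \<le> max 1 T0")
    case True
    then show ?thesis using B[of t] that by (simp add: add_increasing)
  next
    case False
    then have "\<bar>g t / t - L\<bar> < 1" using T0[of t] by (simp add: dist_real_def)
    then have "\<bar>g t / t\<bar> \<le> \<bar>L\<bar> + 1" by linarith
    then have "\<bar>g t\<bar> \<le> (\<bar>L\<bar> + 1) * t" using False by (simp add: abs_divide pos_divide_le_eq)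
    then show ?thesis using \<open>B \<ge> 0\<close> by simp
  qed
  have "((\<lambda>t. LINT s|\<mu>. k s * g (t - s) / t) \<longlongrightarrow> (LINT s|\<mu>. k s * L)) at_top"
  proof (rule integral_dominated_convergence_at_top[where w = "\<lambda>s. \<bar>k s\<bar> * (\<bar>L\<bar> + 1 + B)"])
    show "integrable \<mu> (\<lambda>s. \<bar>k s\<bar> * (\<bar>L\<bar> + 1 + B))" using int by auto
    show "AE s in \<mu>. ((\<lambda>t. k s * g (t - s) / t) \<longlongrightarrow> k s * L) at_top"
    proof (rule AE_I2)
      fix s :: real
      have "filterlim (\<lambda>t. - s + t) at_top at_top"
        using filterlim_tendsto_add_at_top[OF tendsto_const[of "- s"] filterlim_ident] by simp
      then have "((\<lambda>t. g (- s + t) / (- s + t)) \<longlongrightarrow> L) at_top"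
        by (rule filterlim_compose[OF L])
      moreover have "((\<lambda>t. - s / t + 1) \<longlongrightarrow> 0 + 1) at_top"
        by (intro tendsto_add tendsto_const tendsto_divide_0[OF tendsto_const]
            filterlim_at_top_imp_at_infinity filterlim_ident)
      ultimately have "((\<lambda>t. k s * (g (- s + t) / (- s + t) * (- s / t + 1))) \<longlongrightarrow> k s * (L * (0 + 1))) at_top"
        by (intro tendsto_mult tendsto_const)
      moreover have "\<forall>\<^sub>F t in at_top. k s * (g (- s + t) / (- s + t) * (- s / t + 1)) = k s * g (t - s) / t"
        using eventually_gt_at_top[of "max 0 s"] by eventually_elim (auto simp: field_simps)
      ultimately show "((\<lambda>t. k s * g (t - s) / t) \<longlongrightarrow> k s * L) at_top"
        by (simp add: tendsto_cong)
    qed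
    have bound: "\<bar>k s * g (t - s) / t\<bar> \<le> \<bar>k s\<bar> * (\<bar>L\<bar> + 1 + B)" if "t \<ge> 1" "s \<in> space \<mu>" for s t
    proof (cases "0 \<le> s \<and> s \<le> t")
      case True
      have "\<bar>g (t - s)\<bar> \<le> (\<bar>L\<bar> + 1) * (t - s) + B" using True by (intro growth) auto
      also have "\<dots> \<le> (\<bar>L\<bar> + 1) * t + B * t"
        using True \<open>B \<ge> 0\<close> \<open>t \<ge> 1\<close> mult_left_mono[of 1 t B]
        by (intro add_mono mult_left_mono) auto
      finally have "\<bar>g (t - s)\<bar> / t \<le> \<bar>L\<bar> + 1 + B"
        using \<open>t \<ge> 1\<close> by (simp add: pos_divide_le_eq algebra_simps)
      then have "\<bar>k s\<bar> * (\<bar>g (t - s)\<bar> / t) \<le> \<bar>k s\<bar> * (\<bar>L\<bar> + 1 + B)"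
        by (rule mult_left_mono) simp
      then show ?thesis using \<open>t \<ge> 1\<close> by (simp add: abs_mult)
    next
      case False
      then have "k s = 0 \<or> g (t - s) = 0"
        using k that causal_negative[OF g, of "t - s"] by (auto simp: conv_kernel_def not_le)
      then show ?thesis using \<open>B \<ge> 0\<close> by auto
    qed
    show "\<forall>\<^sub>F t in at_top. AE s in \<mu>. norm (k s * g (t - s) / t) \<le> \<bar>k s\<bar> * (\<bar>L\<bar> + 1 + B)"
      using eventually_ge_at_top[of 1]
      by eventually_elim (rule AE_I2, simp only: real_norm_def bound)
  qed measurable
  then show ?thesis
    by (simp add: conv_def mult.commute)
qed

lemma conv_kernel_finite:
  assumes "finite_measure \<mu>" "(\<lambda>s. s) \<in> borel_measurable \<mu>" "\<And>s. s \<in> space \<mu> \<Longrightarrow> 0 \<le> s"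
  shows "conv_kernel \<mu> (\<lambda>_. 1)"
proof -
  interpret finite_measure \<mu> by fact
  note [measurable] = assms(2)
  have "integrable \<mu> (\<lambda>s. indicator {..T} s :: real)" for T
    by (rule integrable_const_bound[of _ 1]) (auto simp: indicator_def)
  moreover have "sigma_finite_measure \<mu>" ..
  ultimately show ?thesis
    using assms by (fastforce simp: conv_kernel_def)
qed

lemma causal_set_integrable:
  assumes "causal g"
  shows "set_integrable lborel {0..T} g"
proof -
  have eq: "(\<lambda>s. indicator {..T} s * g s) = (\<lambda>s. indicator {0..T} s *\<^sub>R g s)"
    using causal_negative[OF assms] by (auto simp: indicator_def fun_eq_iff not_le)
  have "integrable lborel (\<lambda>s. indicator {..T} s * g s)"
    using conv_kernel_causal[OF assms] by (simp add: conv_kernel_def)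
  then show ?thesis
    unfolding eq set_integrable_def .
qed

lemma causal_L1_loc:
  assumes "causal g"
  shows "g \<in> L1_loc"
proof (rule L1_loc_halflineI)
  fix T
  have "integrable lborel (\<lambda>s. indicator {0..T} s *\<^sub>R g s)"
    using causal_set_integrable[OF assms] by (simp add: set_integrable_def)
  then show "set_integrable lebesgue {0..T} g"
    unfolding set_integrable_def
    by (subst integrable_completion) (auto intro: borel_measurable_integrable)
qed

lemma primitive_causal:
  assumes "causal g"
  shows "conv lborel (indicator {0..}) g t = integral {0..t} g"
  using set_borel_integral_eq_integral(2)[OF causal_set_integrable[OF assms]]
  by (simp add: conv_unit[OF assms])

section \<open>The resolvent identity and the slopes of solutions\<close>

text \<open>\<open>P\<close> and \<open>N\<close> stand for the positive and negative variation of a finite signed measure \<open>\<nu>\<close> on the half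
  line. Then \<open>V\<close> below is convolution with \<open>\<nu>\<close>, and \<open>mass\<close> is the total mass of \<open>\<nu>\<close>.\<close>

locale volterra =
  fixes P N :: "real measure" and r :: "real \<Rightarrow> real"
  assumes P: "finite_measure P" "(\<lambda>s. s) \<in> borel_measurable P" "\<And>s. s \<in> space P \<Longrightarrow> 0 \<le> s"
    and N: "finite_measure N" "(\<lambda>s. s) \<in> borel_measurable N" "\<And>s. s \<in> space N \<Longrightarrow> 0 \<le> s"
    and r_causal: "causal r" and r_integrable: "integrable lborel r"
begin

definition V :: "(real \<Rightarrow> real) \<Rightarrow> real \<Rightarrow> real" where
  "V g t = conv P (\<lambda>_. 1) g t - conv N (\<lambda>_. 1) g t"

abbreviation I :: "(real \<Rightarrow> real) \<Rightarrow> real \<Rightarrow> real" where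
  "I \<equiv> conv lborel (indicator {0..})"

definition mass :: real where
  "mass = measure P (space P) - measure N (space N)"

lemmas P_kernel = conv_kernel_finite[OF P]
lemmas N_kernel = conv_kernel_finite[OF N]

lemma causal_V: "causal g \<Longrightarrow> causal (V g)"
  unfolding V_def by (intro causal_diff causal_conv P_kernel N_kernel)

lemma causal_I: "causal g \<Longrightarrow> causal (I g)"
  by (intro causal_conv conv_kernel_causal causal_unit)

lemma V_conv_commute:
  assumes "conv_kernel \<mu> k" "causal g"
  shows "V (conv \<mu> k g) t = conv \<mu> k (V g) t"
  unfolding V_def
  by (simp add: conv_diff[OF assms(1)] causal_conv P_kernel N_kernel assms
      conv_commute[OF P_kernel assms] conv_commute[OF N_kernel assms])

lemma V_slope:
  assumes "causal g" "((\<lambda>t. g t / t) \<longlongrightarrow> L) at_top"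
  shows "((\<lambda>t. V g t / t) \<longlongrightarrow> mass * L) at_top"
proof -
  interpret P: finite_measure P by (rule P)
  interpret N: finite_measure N by (rule N)
  have "((\<lambda>t. conv P (\<lambda>_. 1) g t / t - conv N (\<lambda>_. 1) g t / t)
      \<longlongrightarrow> L * (LINT s|P. 1) - L * (LINT s|N. 1)) at_top"
    by (intro tendsto_diff conv_slope P_kernel N_kernel assms) auto
  then show ?thesis
    by (simp add: V_def mass_def diff_divide_distrib algebra_simps)
qed

lemmas r_slope = conv_slope[OF conv_kernel_causal[OF r_causal] r_integrable]

context
  assumes resolvent: "\<And>t. r t = indicator {0..} t + V (I r) t"
begin

text \<open>Convolution of \<open>E\<close> with \<open>r = 1 + \<nu> * I r\<close>, the integral moved from \<open>r\<close> to \<open>E\<close>. It plays the part of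
  an integration by parts, in which \<open>\<nu> * r\<close> is the derivative of \<open>r\<close>.\<close>

lemma resolvent_conv:
  assumes E: "causal E"
  shows "conv lborel r E t = I E t + V (conv lborel r (I E)) t"
proof -
  have kE: "conv_kernel lborel E" and kr: "conv_kernel lborel r" and kI: "conv_kernel lborel (indicator {0..})"
    by (intro conv_kernel_causal E r_causal causal_unit)+
  have "conv lborel r E t = conv lborel E r t"
    by (rule conv_lborel_commute)
  also have "\<dots> = conv lborel E (\<lambda>t. indicator {0..} t + V (I r) t) t"
    by (rule arg_cong[where f = "\<lambda>h. conv lborel E h t"]) (rule ext, rule resolvent)
  also have "\<dots> = conv lborel E (indicator {0..}) t + conv lborel E (V (I r)) t"
    by (intro conv_add kE causal_unit causal_V causal_I r_causal)
  also have "conv lborel E (indicator {0..}) t = I E t"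
    by (rule conv_lborel_commute)
  also have "conv lborel E (V (I r)) t = V (conv lborel E (I r)) t"
    by (rule V_conv_commute[symmetric]) (intro kE causal_I r_causal)+
  also have "conv lborel E (I r) = conv lborel r (I E)"
  proof
    fix t
    have "conv lborel E (I r) t = I (conv lborel E r) t"
      by (rule conv_commute[OF kE kI r_causal])
    also have "conv lborel E r = conv lborel r E"
      by (intro ext conv_lborel_commute)
    also have "I (conv lborel r E) t = conv lborel r (I E) t"
      by (rule conv_commute[OF kI kr E])
    finally show "conv lborel E (I r) t = conv lborel r (I E) t" .
  qed
  finally show ?thesis .
qed

lemma primitive_unit: "I (indicator {0..}) t = indicator {0..} t * t"
proof -
  have "(\<lambda>s. indicator {0..t} s *\<^sub>R indicator {0..} s) = (indicator {0..t} :: real \<Rightarrow> real)"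
    by (auto simp: indicator_def)
  then show ?thesis
    by (simp add: conv_unit[OF causal_unit] set_lebesgue_integral_def)
qed

lemma primitive_r: "I r = conv lborel r (indicator {0..})"
  by (intro ext conv_lborel_commute)

lemma unit_slope: "((\<lambda>t. indicator {0..} t / t :: real) \<longlongrightarrow> 0) at_top"
proof (rule Lim_transform_eventually)
  show "((\<lambda>t::real. 1 / t) \<longlongrightarrow> 0) at_top"
    by (intro tendsto_divide_0[OF tendsto_const] filterlim_at_top_imp_at_infinity filterlim_ident)
  show "\<forall>\<^sub>F t in at_top. 1 / t = indicator {0..} t / (t::real)"
    using eventually_ge_at_top[of 0] by eventually_elim simp
qed

text \<open>The primitive of \<open>r\<close> is the convolution of \<open>r\<close> with a function of slope 0.\<close>

lemma primitive_r_slope: "((\<lambda>t. I r t / t) \<longlongrightarrow> 0) at_top"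
  unfolding primitive_r using r_slope[OF causal_unit unit_slope] by simp

lemma primitive_unit_slope: "((\<lambda>t. I (indicator {0..}) t / t) \<longlongrightarrow> 1) at_top"
proof (rule Lim_transform_eventually)
  show "((\<lambda>t::real. 1 :: real) \<longlongrightarrow> 1) at_top" by simp
  show "\<forall>\<^sub>F t in at_top. 1 = I (indicator {0..}) t / t"
    using eventually_gt_at_top[of 0] by eventually_elim (simp add: primitive_unit)
qed

text \<open>Compare slopes in \<open>I r = I 1 + \<nu> * (r * I 1)\<close>, where \<open>I 1\<close> is the identity on \<open>{0..}\<close> and has slope 1.\<close>

lemma mass_resolvent: "mass * (LINT s|lborel. r s) = -1"
proof -
  have eq: "I r t / t = I (indicator {0..}) t / t + V (conv lborel r (I (indicator {0..}))) t / t" for t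
    unfolding primitive_r by (simp add: resolvent_conv[OF causal_unit] add_divide_distrib)
  have "((\<lambda>t. I r t / t) \<longlongrightarrow> 1 + mass * (1 * (LINT s|lborel. r s))) at_top"
    unfolding eq
    by (intro tendsto_add primitive_unit_slope V_slope r_slope
      causal_conv causal_I causal_unit conv_kernel_causal r_causal)
  then have "1 + mass * (1 * (LINT s|lborel. r s)) = 0"
    by (rule tendsto_unique[OF trivial_limit_at_top_linorder _ primitive_r_slope])
  then show ?thesis by simp
qed

text \<open>The terms of \<open>r * E = I E + \<nu> * (r * I E)\<close> have slopes \<open>d\<close> and \<open>mass * d\<close> times the integral of
  \<open>r\<close>, and these cancel.\<close>

lemma smoothing_slope:
  assumes E: "causal E" and d: "((\<lambda>t. I E t / t) \<longlongrightarrow> d) at_top"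
  shows "((\<lambda>t. conv lborel r E t / t) \<longlongrightarrow> 0) at_top"
proof -
  have "((\<lambda>t. I E t / t + V (conv lborel r (I E)) t / t) \<longlongrightarrow> d + mass * (d * (LINT s|lborel. r s))) at_top"
    by (intro tendsto_add d V_slope r_slope causal_conv causal_I E conv_kernel_causal r_causal)
  moreover have "d + mass * (d * (LINT s|lborel. r s)) = 0"
    using mass_resolvent by (simp add: algebra_simps)
  ultimately show ?thesis
    by (simp add: resolvent_conv[OF E] add_divide_distrib)
qed

context
  fixes x F :: "real \<Rightarrow> real" and \<xi> :: real
  assumes x: "causal x" and F: "causal F"
    and equation: "\<And>t. x t = \<xi> * indicator {0..} t + V (I x) t + F t"
begin

text \<open>Expand \<open>r * x\<close> in two ways, by the resolvent identity and by the equation for \<open>x\<close>. The term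
  \<open>\<nu> * (r * I x)\<close> occurs in both expansions and cancels.\<close>

lemma variation_of_constants: "I x t = \<xi> * I r t + conv lborel r F t"
proof -
  have kr: "conv_kernel lborel r" by (intro conv_kernel_causal r_causal)
  have "I x t + V (conv lborel r (I x)) t = conv lborel r x t"
    by (rule resolvent_conv[OF x, symmetric])
  also have "\<dots> = conv lborel r (\<lambda>t. \<xi> * indicator {0..} t + V (I x) t + F t) t"
    by (rule arg_cong[where f = "\<lambda>h. conv lborel r h t"]) (rule ext, rule equation)
  also have "\<dots> = conv lborel r (\<lambda>t. \<xi> * indicator {0..} t) t + conv lborel r (V (I x)) t + conv lborel r F t"
    by (simp only: conv_add[OF kr] causal_add causal_cmult causal_unit causal_V causal_I x F)
  also have "conv lborel r (\<lambda>t. \<xi> * indicator {0..} t) t = \<xi> * I r t"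
    by (simp add: conv_cmult primitive_r)
  also have "conv lborel r (V (I x)) t = V (conv lborel r (I x)) t"
    by (rule V_conv_commute[symmetric]) (intro kr causal_I x)+
  finally show ?thesis by simp
qed

text \<open>It suffices that \<open>F\<close> has a slope up to an error whose primitive has one.\<close>

lemma solution_slope:
  assumes G: "causal G" and c: "((\<lambda>t. G t / t) \<longlongrightarrow> c) at_top"
    and d: "((\<lambda>t. I (\<lambda>t. F t - G t) t / t) \<longlongrightarrow> d) at_top"
  shows "((\<lambda>t. I x t / t) \<longlongrightarrow> c * (LINT s|lborel. r s)) at_top"
proof -
  have "conv lborel r F t = conv lborel r G t + conv lborel r (\<lambda>t. F t - G t) t" for t
    using conv_diff[OF conv_kernel_causal[OF r_causal] F G] by simp
  then have eq: "I x t / t = \<xi> * (I r t / t) + conv lborel r G t / t + conv lborel r (\<lambda>t. F t - G t) t / t" for t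
    by (simp add: variation_of_constants add_divide_distrib)
  have "((\<lambda>t. I x t / t) \<longlongrightarrow> \<xi> * 0 + c * (LINT s|lborel. r s) + 0) at_top"
    unfolding eq
    by (intro tendsto_add tendsto_mult tendsto_const primitive_r_slope r_slope G c
        smoothing_slope[OF _ d] causal_diff F)
  then show ?thesis by simp
qed

end

end

end

section \<open>Integrating the differential equation\<close>

lemma positive_variation_halfline:
  assumes "finite_signed_measure borel_Rplus \<nu>"
  shows "finite_measure (positive_variation borel_Rplus \<nu>)"
    and "(\<lambda>s. s) \<in> borel_measurable (positive_variation borel_Rplus \<nu>)"
    and "s \<in> space (positive_variation borel_Rplus \<nu>) \<Longrightarrow> 0 \<le> s"
proof -
  show "finite_measure (positive_variation borel_Rplus \<nu>)"
    by (rule finite_measure_positive_variation[OF assms])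
  have "(\<lambda>s. s) \<in> borel_measurable borel_Rplus"
    by (rule measurable_restrict_space1) simp
  then show "(\<lambda>s. s) \<in> borel_measurable (positive_variation borel_Rplus \<nu>)"
    by (simp add: measurable_cong_sets[OF sets_positive_variation[OF assms] refl])
  show "s \<in> space (positive_variation borel_Rplus \<nu>) \<Longrightarrow> 0 \<le> s"
    by (simp add: space_positive_variation[OF assms] space_restrict_space)
qed

lemma solution_continuous:
  assumes "is_solution \<nu> g \<zeta> y"
  shows "continuous_on {0..} y"
proof (rule continuous_on_halflineI)
  fix T
  show "continuous_on {0..T} y"
  proof (cases "0 \<le> T")
    case True
    then show ?thesis
      using assms by (intro absolutely_continuous_on_imp_continuous_on)
        (simp add: is_solution_def locally_absolutely_continuous_def)
  qed simp
qed

lemma solution_has_integral: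
  assumes sol: "is_solution \<nu> g \<zeta> y" and "0 \<le> t"
  shows "((\<lambda>s. measure_convolution \<nu> y s + g s) has_integral (y t - \<zeta>)) {0..t}"
proof -
  have "AE s in lebesgue. 0 < s \<longrightarrow> s < t \<longrightarrow> (y has_real_derivative measure_convolution \<nu> y s + g s) (at s)"
    using sol unfolding is_solution_def by (auto elim!: eventually_mono)
  moreover have "absolutely_continuous_on {0..t} y" "y 0 = \<zeta>"
    using sol \<open>0 \<le> t\<close> by (auto simp: is_solution_def locally_absolutely_continuous_def)
  ultimately show ?thesis
    using has_integral_absolutely_continuous[OF \<open>0 \<le> t\<close>, of y] by auto
qed

locale cesaro_setting =
  fixes \<nu> :: "real set \<Rightarrow> real" and f x r :: "real \<Rightarrow> real" and \<xi> :: real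
  assumes signed: "finite_signed_measure borel_Rplus \<nu>"
    and f: "f \<in> L1_loc"
    and solution: "is_solution \<nu> f \<xi> x"
    and resolvent: "is_differential_resolvent \<nu> r"
    and r_L1: "set_integrable lebesgue {0..} r"
begin

abbreviation halfline :: "(real \<Rightarrow> real) \<Rightarrow> real \<Rightarrow> real" where
  "halfline g \<equiv> \<lambda>t. indicator {0..} t * g t"

abbreviation primitive :: "(real \<Rightarrow> real) \<Rightarrow> real \<Rightarrow> real" where
  "primitive g \<equiv> \<lambda>t. integral {0..t} g"

lemma resolvent_solution: "is_solution \<nu> (\<lambda>_. 0) 1 r"
  using resolvent by (simp add: is_differential_resolvent_def is_solution_def)

lemmas x_continuous = solution_continuous[OF solution]
lemmas r_continuous = solution_continuous[OF resolvent_solution]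

sublocale volterra "positive_variation borel_Rplus \<nu>" "positive_variation borel_Rplus (\<lambda>A. - \<nu> A)"
  "halfline r"
proof (rule volterra.intro)
  note signed' = finite_signed_measure_uminus[OF signed]
  show "finite_measure (positive_variation borel_Rplus \<nu>)"
    "(\<lambda>s. s) \<in> borel_measurable (positive_variation borel_Rplus \<nu>)"
    "\<And>s. s \<in> space (positive_variation borel_Rplus \<nu>) \<Longrightarrow> 0 \<le> s"
    by (fact positive_variation_halfline[OF signed])+
  show "finite_measure (positive_variation borel_Rplus (\<lambda>A. - \<nu> A))"
    "(\<lambda>s. s) \<in> borel_measurable (positive_variation borel_Rplus (\<lambda>A. - \<nu> A))"
    "\<And>s. s \<in> space (positive_variation borel_Rplus (\<lambda>A. - \<nu> A)) \<Longrightarrow> 0 \<le> s"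
    by (fact positive_variation_halfline[OF signed'])+
  show r: "causal (halfline r)"
    by (rule causal_continuous[OF r_continuous])
  have "integrable lebesgue (halfline r)"
    using r_L1 by (simp add: set_integrable_def)
  then show "integrable lborel (halfline r)"
    using causal_measurable[OF r] by (simp add: integrable_completion)
qed

lemma mass_eq: "mass = \<nu> {0..}"
  using jordan_decomposition_space[OF signed] space_positive_variation[OF signed]
    space_positive_variation[OF finite_signed_measure_uminus[OF signed]]
  by (simp add: mass_def space_restrict_space)

text \<open>On the support \<open>{0..}\<close> of the measure, cutting \<open>y\<close> off on the negative axis is the same as
  integrating over \<open>{0..t}\<close> only.\<close>

lemma measure_convolution_eq:
  assumes "0 \<le> t"
  shows "measure_convolution \<nu> y t = V (halfline y) t"
proof -
  have eq: "indicator {0..t} s * y (t - s) = 1 * halfline y (t - s)" if "0 \<le> s" for s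
    using that by (auto simp: indicator_def)
  show ?thesis
    unfolding measure_convolution_def signed_integral_def V_def conv_def
    by (intro arg_cong2[where f = "(-)"] Bochner_Integration.integral_cong refl eq)
      (rule positive_variation_halfline[OF signed]
        positive_variation_halfline[OF finite_signed_measure_uminus[OF signed]], assumption)+
qed

text \<open>The integral of \<open>\<nu> * y\<close> is \<open>\<nu>\<close> convolved with the primitive of \<open>y\<close>. With vanishing forcing and initial
  value 1 this is the equation of the resolvent.\<close>

lemma integrated_equation:
  assumes sol: "is_solution \<nu> g \<zeta> y" and g: "g \<in> L1_loc"
  shows "halfline y t = \<zeta> * indicator {0..} t + V (I (halfline y)) t + halfline (primitive g) t"
proof (cases "0 \<le> t")
  case False
  then show ?thesis
    using causal_negative[OF causal_V[OF causal_I[OF causal_continuous[OF solution_continuous[OF sol]]]]]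
    by simp
next
  case True
  have y: "causal (halfline y)" by (rule causal_continuous[OF solution_continuous[OF sol]])
  have "((\<lambda>s. V (halfline y) s + g s) has_integral (y t - \<zeta>)) {0..t}"
    using solution_has_integral[OF sol True] True
    by (subst has_integral_cong[where g = "\<lambda>s. measure_convolution \<nu> y s + g s"])
       (auto simp: measure_convolution_eq)
  moreover have "((\<lambda>s. V (halfline y) s + g s) has_integral
      (integral {0..t} (V (halfline y)) + integral {0..t} g)) {0..t}"
    by (intro has_integral_add integrable_integral L1_loc_integrable(2) causal_L1_loc causal_V y g order_refl)
  ultimately have "y t - \<zeta> = integral {0..t} (V (halfline y)) + integral {0..t} g"
    by (rule has_integral_unique)
  also have "integral {0..t} (V (halfline y)) = I (V (halfline y)) t"
    by (rule primitive_causal[OF causal_V[OF y], symmetric])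
  also have "\<dots> = V (I (halfline y)) t"
    by (rule V_conv_commute[OF conv_kernel_causal[OF causal_unit] y, symmetric])
  finally show ?thesis using True by simp
qed

lemma resolvent_equation: "halfline r t = indicator {0..} t + V (I (halfline r)) t"
proof -
  have "(\<lambda>_. 0) \<in> L1_loc" by (rule continuous_L1_loc) simp
  then have "halfline r t
      = 1 * indicator {0..} t + V (I (halfline r)) t + halfline (primitive (\<lambda>_. 0)) t"
    by (rule integrated_equation[OF resolvent_solution])
  also have "\<dots> = indicator {0..} t + V (I (halfline r)) t"
    by simp
  finally show ?thesis .
qed

lemmas solution_equation = integrated_equation[OF solution f]

lemmas total_mass = mass_resolvent[OF resolvent_equation, unfolded mass_eq]

lemma causal_x: "causal (halfline x)"
  by (rule causal_continuous[OF x_continuous])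

lemma causal_F: "causal (halfline (primitive f))"
  by (rule causal_continuous[OF primitive_continuous[OF f]])

lemma primitive_halfline:
  assumes "causal (halfline g)"
  shows "I (halfline g) t = integral {0..t} g"
  unfolding primitive_causal[OF assms] by (rule Henstock_Kurzweil_Integration.integral_cong) simp

lemma I_x: "I (halfline x) = primitive x"
  by (rule ext) (rule primitive_halfline[OF causal_x])

lemma slope_halfline: "((\<lambda>t. halfline g t / t) \<longlongrightarrow> L) at_top \<longleftrightarrow> ((\<lambda>t. g t / t) \<longlongrightarrow> L) at_top"
proof (rule tendsto_cong)
  show "\<forall>\<^sub>F t in at_top. halfline g t / t = g t / t"
    using eventually_ge_at_top[of 0] by eventually_elim simp
qed

lemma slope_const: "((\<lambda>t. c / t :: real) \<longlongrightarrow> 0) at_top"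
  by (intro tendsto_divide_0[OF tendsto_const] filterlim_at_top_imp_at_infinity filterlim_ident)

lemma x_L1_loc: "x \<in> L1_loc"
  by (rule continuous_L1_loc[OF x_continuous])

lemma x_eq:
  assumes "0 \<le> t"
  shows "x t = \<xi> + V (primitive x) t + primitive f t"
  using solution_equation[of t] assms by (simp add: I_x)

lemma V_primitive_x_slope:
  assumes "((\<lambda>t. primitive x t / t) \<longlongrightarrow> L) at_top"
  shows "((\<lambda>t. V (primitive x) t / t) \<longlongrightarrow> \<nu> {0..} * L) at_top"
  using V_slope[OF causal_I[OF causal_x], of L] assms by (simp add: I_x mass_eq)

lemma forcing_mean_imp_solution_mean:
  assumes C: "((\<lambda>t. primitive f t / t) \<longlongrightarrow> C) at_top"
  shows "((\<lambda>t. primitive x t / t) \<longlongrightarrow> C * (LINT s|lborel. halfline r s)) at_top"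
proof -
  have "((\<lambda>t. I (halfline x) t / t) \<longlongrightarrow> C * (LINT s|lborel. halfline r s)) at_top"
  proof (rule solution_slope[OF resolvent_equation causal_x causal_F solution_equation causal_F])
    show "((\<lambda>t. halfline (primitive f) t / t) \<longlongrightarrow> C) at_top"
      using C by (simp add: slope_halfline)
    show "((\<lambda>t. I (\<lambda>t. halfline (primitive f) t - halfline (primitive f) t) t / t) \<longlongrightarrow> 0) at_top"
      by (simp add: conv_def)
  qed
  then show ?thesis by (simp add: I_x)
qed

lemma derivative_primitive:
  assumes "0 \<le> t"
  shows "(deriv x has_integral (x t - \<xi>)) {0..t}"
proof -
  have "AE s in lebesgue. s > 0 \<longrightarrow> (x has_real_derivative measure_convolution \<nu> x s + f s) (at s)"
    using solution by (simp add: is_solution_def)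
  then have "AE s in lebesgue. 0 < s \<longrightarrow> s < t \<longrightarrow> (x has_real_derivative deriv x s) (at s)"
    by (rule eventually_mono) (metis DERIV_imp_deriv)
  moreover have "absolutely_continuous_on {0..t} x" "x 0 = \<xi>"
    using solution \<open>0 \<le> t\<close> by (auto simp: is_solution_def locally_absolutely_continuous_def)
  ultimately show ?thesis
    using has_integral_absolutely_continuous[OF \<open>0 \<le> t\<close>, of x] by auto
qed

lemma derivative_L1_loc: "deriv x \<in> L1_loc"
proof (rule L1_loc_halflineI)
  fix T
  obtain S where S: "negligible S" "\<And>s. s \<notin> S \<Longrightarrow> 0 < s \<Longrightarrow>
      (x has_real_derivative measure_convolution \<nu> x s + f s) (at s)"
    using solution unfolding is_solution_def eventually_ae_filter_negligible by blast
  have "(\<lambda>s. V (halfline x) s + f s) absolutely_integrable_on {0..T}"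
    by (intro set_integral_add L1_loc_integrable(1) causal_L1_loc causal_V causal_x f order_refl)
  then show "deriv x absolutely_integrable_on {0..T}"
  proof (rule absolutely_integrable_spike)
    show "negligible (insert 0 S)" using S by simp
    show "deriv x s = V (halfline x) s + f s" if "s \<in> {0..T} - insert 0 S" for s
      using that S(2)[of s] by (auto simp: measure_convolution_eq dest!: DERIV_imp_deriv)
  qed
qed

text \<open>The primitive of the derivative is \<open>x t - \<xi>\<close>, and constants have slope 0.\<close>

lemma derivative_mean_iff:
  "((\<lambda>t. primitive (deriv x) t / t) \<longlongrightarrow> K) at_top \<longleftrightarrow> ((\<lambda>t. x t / t) \<longlongrightarrow> K) at_top"
proof -
  have "((\<lambda>t. primitive (deriv x) t / t) \<longlongrightarrow> K) at_top \<longleftrightarrow> ((\<lambda>t. x t / t - \<xi> / t) \<longlongrightarrow> K) at_top"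
  proof (rule tendsto_cong)
    show "\<forall>\<^sub>F t in at_top. primitive (deriv x) t / t = x t / t - \<xi> / t"
      using eventually_ge_at_top[of 0]
      by eventually_elim (simp add: integral_unique[OF derivative_primitive] diff_divide_distrib)
  qed
  also have "\<dots> \<longleftrightarrow> ((\<lambda>t. x t / t) \<longlongrightarrow> K) at_top"
    using tendsto_diff[of "\<lambda>t. x t / t" K at_top "\<lambda>t. \<xi> / t" 0]
      tendsto_add[of "\<lambda>t. x t / t - \<xi> / t" K at_top "\<lambda>t. \<xi> / t" 0] slope_const[of \<xi>]
    by auto
  finally show ?thesis .
qed

text \<open>The equation \<open>x = \<xi> + \<nu> * X + F\<close> determines the slope of either of \<open>x\<close> and \<open>F\<close> from the other one,
  once the slope of \<open>X\<close> is known.\<close>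

lemma slopes_of_equation:
  assumes L: "((\<lambda>t. primitive x t / t) \<longlongrightarrow> L) at_top"
  shows "((\<lambda>t. primitive f t / t) \<longlongrightarrow> C) at_top \<Longrightarrow> ((\<lambda>t. x t / t) \<longlongrightarrow> \<nu> {0..} * L + C) at_top"
    and "((\<lambda>t. x t / t) \<longlongrightarrow> K) at_top \<Longrightarrow> ((\<lambda>t. primitive f t / t) \<longlongrightarrow> K - \<nu> {0..} * L) at_top"
proof -
  note V = V_primitive_x_slope[OF L]
  show "((\<lambda>t. x t / t) \<longlongrightarrow> \<nu> {0..} * L + C) at_top" if C: "((\<lambda>t. primitive f t / t) \<longlongrightarrow> C) at_top"
  proof (rule Lim_transform_eventually)
    show "((\<lambda>t. \<xi> / t + V (primitive x) t / t + primitive f t / t) \<longlongrightarrow> \<nu> {0..} * L + C) at_top"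
      using tendsto_add[OF tendsto_add[OF slope_const V] C] by simp
    show "\<forall>\<^sub>F t in at_top. \<xi> / t + V (primitive x) t / t + primitive f t / t = x t / t"
      using eventually_ge_at_top[of 0] by eventually_elim (simp add: x_eq add_divide_distrib)
  qed
  show "((\<lambda>t. primitive f t / t) \<longlongrightarrow> K - \<nu> {0..} * L) at_top" if K: "((\<lambda>t. x t / t) \<longlongrightarrow> K) at_top"
  proof (rule Lim_transform_eventually)
    show "((\<lambda>t. x t / t - \<xi> / t - V (primitive x) t / t) \<longlongrightarrow> K - \<nu> {0..} * L) at_top"
      using tendsto_diff[OF tendsto_diff[OF K slope_const] V] by simp
    show "\<forall>\<^sub>F t in at_top. x t / t - \<xi> / t - V (primitive x) t / t = primitive f t / t"
      using eventually_ge_at_top[of 0] by eventually_elim (simp add: x_eq add_divide_distrib)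
  qed
qed

lemma F_continuous: "continuous_on {0..} (primitive f)"
  by (rule primitive_continuous[OF f])

lemma window_eq:
  assumes "0 \<le> \<theta>" "0 \<le> s"
  shows "(LINT u:{s..s+\<theta>}|lebesgue. f u) = primitive f (s + \<theta>) - primitive f s"
  using L1_loc_integrable(3)[OF f assms(2)] primitive_increment[OF f assms(2,1)] by simp

lemma window_L1_loc:
  assumes "0 \<le> \<theta>"
  shows "(\<lambda>s. LINT u:{s..s+\<theta>}|lebesgue. f u) \<in> L1_loc"
proof (rule continuous_L1_loc)
  have "continuous_on {0..} (\<lambda>s. primitive f (s + \<theta>) - primitive f s)"
    by (intro continuous_intros continuous_on_shifted[OF F_continuous assms] F_continuous)
  then show "continuous_on {0..} (\<lambda>s. LINT u:{s..s+\<theta>}|lebesgue. f u)"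
    by (rule continuous_on_eq) (simp add: window_eq assms)
qed

text \<open>The primitive of the window integrals is an increment of the second primitive of \<open>f\<close>, up to a
  constant.\<close>

lemma window_mean_iff:
  assumes "0 \<le> \<theta>"
  shows "(cesaro_mean (\<lambda>s. LINT u:{s..s+\<theta>}|lebesgue. f u) \<longlongrightarrow> c) at_top \<longleftrightarrow>
    ((\<lambda>t. (primitive (primitive f) (t + \<theta>) - primitive (primitive f) t) / t) \<longlongrightarrow> c) at_top"
    (is "_ \<longleftrightarrow> (?q \<longlongrightarrow> c) at_top")
proof -
  let ?c = "primitive (primitive f) \<theta>"
  have "integral {0..t} (\<lambda>s. LINT u:{s..s+\<theta>}|lebesgue. f u) / t = ?q t - ?c / t" if "0 \<le> t" for t
  proof -
    have "integral {0..t} (\<lambda>s. LINT u:{s..s+\<theta>}|lebesgue. f u)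
        = integral {0..t} (\<lambda>s. primitive f (s + \<theta>) - primitive f s)"
      by (rule Henstock_Kurzweil_Integration.integral_cong) (simp add: window_eq assms)
    also have "\<dots> = primitive (primitive f) (t + \<theta>) - ?c - primitive (primitive f) t"
      by (rule integral_increments[OF F_continuous assms that])
    finally show ?thesis by (simp add: diff_divide_distrib)
  qed
  then have "\<forall>\<^sub>F t in at_top. integral {0..t} (\<lambda>s. LINT u:{s..s+\<theta>}|lebesgue. f u) / t = ?q t - ?c / t"
    using eventually_ge_at_top[of 0] by (rule eventually_mono[rotated])
  then have "(cesaro_mean (\<lambda>s. LINT u:{s..s+\<theta>}|lebesgue. f u) \<longlongrightarrow> c) at_top
      \<longleftrightarrow> ((\<lambda>t. ?q t - ?c / t) \<longlongrightarrow> c) at_top"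
    unfolding cesaro_mean_tendsto_iff[OF window_L1_loc[OF assms]] by (rule tendsto_cong)
  also have "\<dots> \<longleftrightarrow> (?q \<longlongrightarrow> c) at_top"
    using tendsto_diff[of ?q c at_top "\<lambda>t. ?c / t" 0]
      tendsto_add[of "\<lambda>t. ?q t - ?c / t" c at_top "\<lambda>t. ?c / t" 0] slope_const[of ?c]
    by auto
  finally show ?thesis .
qed

text \<open>Two integrations of the equation give \<open>G t = X t - \<xi> t - (I W) t\<close> with \<open>W = \<nu> * X\<close>. The increments of
  \<open>X\<close> have slope 0, those of \<open>\<xi> t\<close> are constant, and \<open>W\<close> has slope \<open>\<nu> {0..} * L\<close>.\<close>

lemma solution_mean_imp_window_mean:
  assumes L: "((\<lambda>t. primitive x t / t) \<longlongrightarrow> L) at_top" and "0 < \<theta>"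
  shows "(cesaro_mean (\<lambda>s. LINT u:{s..s+\<theta>}|lebesgue. f u) \<longlongrightarrow> - (\<nu> {0..} * L) * \<theta>) at_top"
proof -
  define W where "W = V (primitive x)"
  have W: "continuous_on {0..} W"
  proof (rule continuous_on_eq)
    show "continuous_on {0..} (\<lambda>t. x t - \<xi> - primitive f t)"
      by (intro continuous_intros x_continuous F_continuous)
  qed (simp add: W_def x_eq)
  have G: "primitive (primitive f) t = primitive x t - \<xi> * t - primitive W t" if "0 \<le> t" for t
  proof -
    have int: "x integrable_on {0..t}" "W integrable_on {0..t}"
      by (intro L1_loc_integrable(2) continuous_L1_loc x_continuous W order_refl)+
    have "primitive (primitive f) t = integral {0..t} (\<lambda>s. x s - \<xi> - W s)"
      by (rule Henstock_Kurzweil_Integration.integral_cong) (simp add: x_eq W_def)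
    also have "\<dots> = integral {0..t} (\<lambda>s. x s - \<xi>) - primitive W t"
      by (intro Henstock_Kurzweil_Integration.integral_diff integrable_diff int integrable_const_ivl)
    also have "integral {0..t} (\<lambda>s. x s - \<xi>) = primitive x t - \<xi> * t"
      using that by (subst Henstock_Kurzweil_Integration.integral_diff[OF int(1) integrable_const_ivl]) simp
    finally show ?thesis .
  qed
  have "((\<lambda>t. primitive x (t + \<theta>) / t - primitive x t / t - \<xi> * \<theta> / t
      - (primitive W (t + \<theta>) - primitive W t) / t) \<longlongrightarrow> L - L - 0 - \<nu> {0..} * L * \<theta>) at_top"
  proof (intro tendsto_diff)
    show "((\<lambda>t. primitive x (t + \<theta>) / t) \<longlongrightarrow> L) at_top"
      by (rule shifted_slope[OF L, of "\<lambda>t. t + \<theta>" \<theta>]) (use \<open>0 < \<theta>\<close> in auto)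
    show "((\<lambda>t. (primitive W (t + \<theta>) - primitive W t) / t) \<longlongrightarrow> \<nu> {0..} * L * \<theta>) at_top"
      by (rule increment_of_primitive_slope[OF W _ \<open>0 < \<theta>\<close>])
        (simp add: W_def V_primitive_x_slope[OF L])
  qed (rule L slope_const)+
  moreover have "\<forall>\<^sub>F t in at_top. primitive x (t + \<theta>) / t - primitive x t / t - \<xi> * \<theta> / t
      - (primitive W (t + \<theta>) - primitive W t) / t
      = (primitive (primitive f) (t + \<theta>) - primitive (primitive f) t) / t"
    using eventually_ge_at_top[of 0]
    by eventually_elim (use \<open>0 < \<theta>\<close> in \<open>simp add: G diff_divide_distrib add_divide_distrib algebra_simps\<close>)
  ultimately have "((\<lambda>t. (primitive (primitive f) (t + \<theta>) - primitive (primitive f) t) / t)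
      \<longlongrightarrow> L - L - 0 - \<nu> {0..} * L * \<theta>) at_top"
    by (rule Lim_transform_eventually)
  then show ?thesis
    using \<open>0 < \<theta>\<close> by (subst window_mean_iff) auto
qed

text \<open>Write \<open>F\<close> as its moving average \<open>M\<close> plus a remainder. The average has slope \<open>c 1\<close>, and the primitive of
  the remainder has a slope as the average over \<open>\<theta>\<close> of increments with a linear bound.\<close>

lemma window_means_imp_solution_mean:
  assumes "\<And>\<theta>. \<theta> \<in> {0<..1} \<Longrightarrow> (\<lambda>s. LINT u:{s..s+\<theta>}|lebesgue. f u) \<in> Ces"
  shows "\<exists>L. ((\<lambda>t. primitive x t / t) \<longlongrightarrow> L) at_top"
proof -
  let ?F = "primitive f" and ?G = "primitive (primitive f)"
  have G: "continuous_on {0..} ?G"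
    by (rule primitive_continuous[OF continuous_L1_loc[OF F_continuous]])
  have "\<exists>c. ((\<lambda>t. (?G (t + \<theta>) - ?G t) / t) \<longlongrightarrow> c) at_top" if "\<theta> \<in> {0..1}" for \<theta>
  proof (cases "\<theta> = 0")
    case True
    then show ?thesis by auto
  next
    case False
    then show ?thesis
      using that assms[of \<theta>] window_mean_iff[of \<theta>] by (auto simp: Ces_def)
  qed
  then have "\<forall>\<theta>\<in>{0..1}. \<exists>c. ((\<lambda>t. (?G (t + \<theta>) - ?G t) / t) \<longlongrightarrow> c) at_top"
    by blast
  from bchoice[OF this] obtain c
    where c: "\<And>\<theta>. \<theta> \<in> {0..1} \<Longrightarrow> ((\<lambda>t. (?G (t + \<theta>) - ?G t) / t) \<longlongrightarrow> c \<theta>) at_top"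
    by blast
  obtain K where K: "\<And>t \<theta>. t \<ge> 2 \<Longrightarrow> \<theta> \<in> {0..1} \<Longrightarrow> \<bar>?G (t + \<theta>) - ?G t\<bar> \<le> K * t"
    using increments_locally_bounded[OF G c] by blast
  obtain d where d: "((\<lambda>t. integral {0..1} (\<lambda>\<theta>. ?G (t + \<theta>) - ?G t) / t) \<longlongrightarrow> d) at_top"
    using averaged_increment_slope[OF G c K] by blast
  define M where "M t = ?G (t + 1) - ?G t" for t
  have M: "continuous_on {0..} M"
    unfolding M_def by (intro continuous_intros G continuous_on_shifted[OF G]) simp
  have "((\<lambda>t. I (halfline x) t / t) \<longlongrightarrow> c 1 * (LINT s|lborel. halfline r s)) at_top"
  proof (rule solution_slope[OF resolvent_equation causal_x causal_F solution_equation causal_continuous[OF M]])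
    show "((\<lambda>t. halfline M t / t) \<longlongrightarrow> c 1) at_top"
      unfolding slope_halfline M_def using c[of 1] by simp
    show "((\<lambda>t. I (\<lambda>t. halfline ?F t - halfline M t) t / t) \<longlongrightarrow> - d + 0) at_top"
    proof (rule Lim_transform_eventually)
      show "((\<lambda>t. - (integral {0..1} (\<lambda>\<theta>. ?G (t + \<theta>) - ?G t) / t) + integral {0..1} ?G / t) \<longlongrightarrow> - d + 0) at_top"
        by (intro tendsto_add tendsto_minus d slope_const)
      show "\<forall>\<^sub>F t in at_top. - (integral {0..1} (\<lambda>\<theta>. ?G (t + \<theta>) - ?G t) / t) + integral {0..1} ?G / t
          = I (\<lambda>t. halfline ?F t - halfline M t) t / t"
        using eventually_ge_at_top[of 0]
      proof eventually_elim
        case (elim t)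
        have Gt: "continuous_on {0..1} (\<lambda>\<theta>. ?G (t + \<theta>))"
          using continuous_on_shifted[OF G elim] by (auto simp: add.commute intro: continuous_on_subset)
        have "I (\<lambda>t. halfline ?F t - halfline M t) t = integral {0..t} (\<lambda>t. halfline ?F t - halfline M t)"
          by (intro primitive_causal causal_diff causal_F causal_continuous M)
        also have "\<dots> = integral {0..t} (\<lambda>s. ?F s - (?G (s + 1) - ?G s))"
          by (rule Henstock_Kurzweil_Integration.integral_cong) (simp add: M_def)
        also have "\<dots> = - integral {0..1} (\<lambda>\<theta>. ?G (t + \<theta>) - ?G \<theta> - ?G t)"
          by (rule integral_minus_moving_average[OF F_continuous elim])
        also have "integral {0..1} (\<lambda>\<theta>. ?G (t + \<theta>) - ?G \<theta> - ?G t)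
            = integral {0..1} (\<lambda>\<theta>. (?G (t + \<theta>) - ?G t) - ?G \<theta>)"
          by (rule Henstock_Kurzweil_Integration.integral_cong) simp
        also have "\<dots> = integral {0..1} (\<lambda>\<theta>. ?G (t + \<theta>) - ?G t) - integral {0..1} ?G"
          by (intro Henstock_Kurzweil_Integration.integral_diff integrable_continuous_real
              continuous_intros Gt continuous_on_subset[OF G]) auto
        finally show ?case by (simp add: diff_divide_distrib)
      qed
    qed
  qed
  then show ?thesis by (auto simp: I_x)
qed

end

section \<open>Solutions with a Cesaro mean\<close>

theorem theorem3:
  fixes \<nu> :: "real set \<Rightarrow> real" and f x r :: "real \<Rightarrow> real" and \<xi> :: real
  assumes "finite_signed_measure borel_Rplus \<nu>"
    and "f \<in> L1_loc"
    and "is_solution \<nu> f \<xi> x"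
    and "is_differential_resolvent \<nu> r"
    and "set_integrable lebesgue {0..} r"
  shows
    "((\<forall>\<theta>\<in>{0<..1}. (\<lambda>t. LINT s:{t..t+\<theta>}|lebesgue. f s) \<in> Ces) \<longleftrightarrow> x \<in> Ces) \<and>
     (f \<in> Ces \<longleftrightarrow> x \<in> Ces \<and> deriv x \<in> Ces) \<and>
     \<nu> {0..} \<noteq> 0 \<and>
     ((\<forall>\<theta>\<in>{0<..1}. (\<lambda>t. LINT s:{t..t+\<theta>}|lebesgue. f s) \<in> Ces) \<longrightarrow>
       (\<exists>C. (\<forall>\<theta>\<in>{0<..1}.
               (cesaro_mean (\<lambda>s. LINT u:{s..s+\<theta>}|lebesgue. f u) \<longlongrightarrow> C * \<theta>) at_top) \<and>
            (cesaro_mean x \<longlongrightarrow> - C / \<nu> {0..}) at_top)) \<and>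
     (f \<in> Ces \<longrightarrow>
       (\<exists>C. (cesaro_mean f \<longlongrightarrow> C) at_top \<and>
            (cesaro_mean x \<longlongrightarrow> - C / \<nu> {0..}) at_top \<and>
            (cesaro_mean (deriv x) \<longlongrightarrow> 0) at_top))"
    (is "(?windows \<longleftrightarrow> _) \<and> _")
proof -
  interpret cesaro_setting \<nu> f x r \<xi>
    by unfold_locales fact+
  have nonzero: "\<nu> {0..} \<noteq> 0"
    using total_mass by auto
  have resolvent_integral: "(LINT s|lborel. halfline r s) = - 1 / \<nu> {0..}"
    using total_mass nonzero by (simp add: field_simps)
  have x_iff: "x \<in> Ces \<longleftrightarrow> (\<exists>L. ((\<lambda>t. primitive x t / t) \<longlongrightarrow> L) at_top)"
    by (simp add: mem_Ces_iff x_L1_loc)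
  have f_iff: "f \<in> Ces \<longleftrightarrow> (\<exists>C. ((\<lambda>t. primitive f t / t) \<longlongrightarrow> C) at_top)"
    by (simp add: mem_Ces_iff f)
  have dx_iff: "deriv x \<in> Ces \<longleftrightarrow> (\<exists>K. ((\<lambda>t. x t / t) \<longlongrightarrow> K) at_top)"
    by (simp add: mem_Ces_iff derivative_L1_loc derivative_mean_iff)
  have windows_imp: "\<exists>L. ((\<lambda>t. primitive x t / t) \<longlongrightarrow> L) at_top" if ?windows
    using that by (intro window_means_imp_solution_mean) blast
  have windows: "?windows" if L: "((\<lambda>t. primitive x t / t) \<longlongrightarrow> L) at_top" for L
    using solution_mean_imp_window_mean[OF L] window_L1_loc by (force simp: Ces_def)
  have f_imp: "((\<lambda>t. primitive x t / t) \<longlongrightarrow> - C / \<nu> {0..}) at_top \<and> ((\<lambda>t. x t / t) \<longlongrightarrow> 0) at_top"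
    if C: "((\<lambda>t. primitive f t / t) \<longlongrightarrow> C) at_top" for C
  proof -
    have L: "((\<lambda>t. primitive x t / t) \<longlongrightarrow> - C / \<nu> {0..}) at_top"
      using forcing_mean_imp_solution_mean[OF C] by (simp add: resolvent_integral)
    from slopes_of_equation(1)[OF L C] L show ?thesis
      using nonzero by simp
  qed
  have i: "?windows \<longleftrightarrow> x \<in> Ces"
    using windows_imp windows x_iff by blast
  have ii: "f \<in> Ces \<longleftrightarrow> x \<in> Ces \<and> deriv x \<in> Ces"
    unfolding f_iff x_iff dx_iff using f_imp slopes_of_equation(2) by blast
  have limits_i: "\<exists>C. (\<forall>\<theta>\<in>{0<..1}.
               (cesaro_mean (\<lambda>s. LINT u:{s..s+\<theta>}|lebesgue. f u) \<longlongrightarrow> C * \<theta>) at_top) \<and>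
            (cesaro_mean x \<longlongrightarrow> - C / \<nu> {0..}) at_top" if w: ?windows
  proof -
    obtain L where L: "((\<lambda>t. primitive x t / t) \<longlongrightarrow> L) at_top"
      using windows_imp[OF w] by blast
    have "- (- (\<nu> {0..} * L)) / \<nu> {0..} = L" using nonzero by simp
    then have "(cesaro_mean x \<longlongrightarrow> - (- (\<nu> {0..} * L)) / \<nu> {0..}) at_top"
      using L cesaro_mean_tendsto_iff[OF x_L1_loc] by simp
    then show ?thesis
      using solution_mean_imp_window_mean[OF L] by (intro exI[of _ "- (\<nu> {0..} * L)"]) auto
  qed
  have limits_ii: "\<exists>C. (cesaro_mean f \<longlongrightarrow> C) at_top \<and>
            (cesaro_mean x \<longlongrightarrow> - C / \<nu> {0..}) at_top \<and>
            (cesaro_mean (deriv x) \<longlongrightarrow> 0) at_top" if "f \<in> Ces"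
    using that f_imp unfolding f_iff cesaro_mean_tendsto_iff[OF f]
      cesaro_mean_tendsto_iff[OF x_L1_loc] cesaro_mean_tendsto_iff[OF derivative_L1_loc]
      derivative_mean_iff by blast
  show ?thesis
    using i ii nonzero limits_i limits_ii by (intro conjI impI)
qed

end
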